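(* Let $g$ be a non-constant meromorphic function on $\mathbb{C}$ of finite logarithmic order $\rho_{\log}(g)$, let $q\in\mathbb{C}\setminus\{0,1\}$, $c\in\mathbb{C}$, and let $k\ge1$ be an integer. Then for any given $\varepsilon>0$, $$m\left(r,\frac{\mathcal{D}_{q,c}^{k}g(z)}{g(z)}\right)=O\left((\log r)^{\rho_{\log}(g)-1+\varepsilon}\right)\quad\text{as } r\to\infty.$$
   Context: For $q\in\mathbb{C}\setminus\{0,1\}$, $c\in\mathbb{C}$ and $g$ meromorphic on $\mathbb{C}$, the Hahn difference operator is $\mathcal{D}_{q,c}g(z)=\frac{g(qz+c)-g(z)}{(q-1)z+c}$, with iterates $\mathcal{D}_{q,c}^{0}g=g$ and $\mathcal{D}_{q,c}^{k}g=\mathcal{D}_{q,c}(\mathcal{D}_{q,c}^{k-1}g)$ for $k\ge1$. $m(r,\cdot)$ and $T(r,\cdot)$ are the Nevanlinna proximity and characteristic functions. The logarithmic order of $g$ is $\rho_{\log}(g)=\limsup_{r\to\infty}\frac{\log^{+}T(r,g)}{\log\log r}$. *)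

theory Defs
  imports "HOL-Complex_Analysis.Complex_Analysis" "HOL-Library.Landau_Symbols"
    "HOL-Library.Extended_Real" "HOL-Library.Liminf_Limsup"
begin

text \<open>
  Meromorphic functions on the plane are total functions \<^term>\<open>f :: complex \<Rightarrow> complex\<close> with
  \<^prop>\<open>f meromorphic_on UNIV\<close>. Their values at poles, and on a set without limit points in
  general, are arbitrary. None of the quantities below depends on these values: circles meet such a
  set in finitely many points, and \<^const>\<open>is_pole\<close> and \<^const>\<open>zorder\<close> only look at punctured
  neighbourhoods.
\<close>

definition log_plus :: "real \<Rightarrow> real" where
  "log_plus x = ln (max 1 x)"

definition proximity :: "(complex \<Rightarrow> complex) \<Rightarrow> real \<Rightarrow> real" where
  "proximity f r =
     1 / (2 * pi) * integral {0..2 * pi} (\<lambda>\<theta>. log_plus (norm (f (of_real r * cis \<theta>))))"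

definition pole_count :: "(complex \<Rightarrow> complex) \<Rightarrow> real \<Rightarrow> nat" where
  "pole_count f r = (\<Sum>z | norm z \<le> r \<and> is_pole f z. nat (- zorder f z))"

definition integrated_pole_count :: "(complex \<Rightarrow> complex) \<Rightarrow> real \<Rightarrow> real" where
  "integrated_pole_count f r =
     integral {0..r} (\<lambda>t. (real (pole_count f t) - real (pole_count f 0)) / t)
       + real (pole_count f 0) * ln r"

definition nevanlinna_char :: "(complex \<Rightarrow> complex) \<Rightarrow> real \<Rightarrow> real" where
  "nevanlinna_char f r = proximity f r + integrated_pole_count f r"

definition log_order :: "(complex \<Rightarrow> complex) \<Rightarrow> ereal" where
  "log_order f = Limsup at_top (\<lambda>r. ereal (log_plus (nevanlinna_char f r) / ln (ln r)))"

text \<open>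
  At the fixed point \<open>c / (1 - q)\<close> of \<open>z \<mapsto> q z + c\<close> (if \<open>q \<noteq> 1\<close>) the quotient below is \<open>0 / 0 = 0\<close>;
  this is one of the immaterial exceptional values. The \<open>k\<close>-th iterate of the operator is
  \<open>hahn_diff q c ^^ k\<close>.
\<close>

definition hahn_diff :: "complex \<Rightarrow> complex \<Rightarrow> (complex \<Rightarrow> complex) \<Rightarrow> complex \<Rightarrow> complex" where
  "hahn_diff q c g z = (g (q * z + c) - g z) / ((q - 1) * z + c)"

text \<open>
  As values on a set without limit points are immaterial, being constant means agreeing with a
  constant outside such a set.
\<close>

definition nonconstant_meromorphic :: "(complex \<Rightarrow> complex) \<Rightarrow> bool" where
  "nonconstant_meromorphic g \<longleftrightarrow> g meromorphic_on UNIV \<and> \<not> (\<exists>a. \<forall>\<^sub>\<approx>z. g z = a)"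

end

theory Submission
  imports Defs
begin

text \<open>
  On a disc of radius \<open>R\<close> write \<open>g z = (\<Prod>s. (z - s) powi n\<^sub>s) * exp (h z)\<close>, where \<open>s\<close> runs over the zeros and
  poles in the disc and \<open>h\<close> is holomorphic. Then \<open>g (a z + b) / g z\<close> is a product of factors
  \<open>((a z + b - s) / (z - s)) powi n\<^sub>s\<close> and of \<open>exp (h (a z + b) - h z)\<close>. The logarithm of each of the former has
  a mean over \<open>|z| = r\<close> which is bounded uniformly in \<open>r\<close> and \<open>s\<close>. By the Schwarz integral formula,
  \<open>h (a z + b) - h z\<close> is \<open>O(r / R)\<close> times the mean of \<open>|Re h|\<close> over the circle of radius \<open>R\<close>, which by Jensen's
  formula is controlled by \<open>T(R, g)\<close> and the number \<open>n(R)\<close> of zeros and poles; with \<open>R\<close> between \<open>r\<^sup>2\<close> and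
  \<open>r\<^sup>3\<close> this tends to \<open>0\<close>. What remains is \<open>O(n(r\<^sup>3))\<close>, and \<open>n(r) ln r \<le> 2 T(R, g) + O(1)\<close> for \<open>R \<ge> r\<^sup>2\<close>
  gains the factor \<open>ln r\<close> over the growth of \<open>T\<close>. Finally, \<open>\<D>\<^sup>k g\<close> is for large \<open>|z|\<close> dominated by the values
  \<open>g (q\<^sup>j z + c\<^sub>j)\<close> with \<open>j \<le> k\<close>.
\<close>

subsection \<open>Integral formulas on circles\<close>

text \<open>The factor \<open>R * cis t\<close> in the numerator comes from
  \<open>du = \<i> * u dt\<close> on the circle.\<close>

lemma circle_Cauchy_formula:
  fixes f :: "complex \<Rightarrow> complex"
  assumes "f holomorphic_on A" "open A" "cball 0 R \<subseteq> A" "norm w < R"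
  shows "((\<lambda>t. f (R * cis t) * (R * cis t) / (R * cis t - w)) has_integral 2 * pi * f w) {0..2 * pi}"
proof -
  have "((\<lambda>u. f u / (u - w)) has_contour_integral 2 * of_real pi * \<i> * f w) (circlepath 0 R)"
  proof (rule Cauchy_integral_circlepath)
    show "continuous_on (cball 0 R) f"
      using holomorphic_on_subset[OF assms(1,3)] by (rule holomorphic_on_imp_continuous_on)
    show "f holomorphic_on ball 0 R"
      using assms(3) ball_subset_cball by (intro holomorphic_on_subset[OF assms(1)]) blast
  qed (use assms in auto)
  hence "((\<lambda>t. f (0 + R * cis t) / ((0 + R * cis t) - w) * R * \<i> * cis t) has_integral
      2 * of_real pi * \<i> * f w) {0..2 * pi}"
    unfolding circlepath_def by (subst (asm) has_contour_integral_part_circlepath_iff) auto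
  from has_integral_mult_left[OF this, of "- \<i>"] show ?thesis
    by (simp add: field_simps)
qed

lemma circle_mean_value:
  fixes f :: "complex \<Rightarrow> complex"
  assumes "f holomorphic_on A" "open A" "cball 0 R \<subseteq> A" "R > 0"
  shows "((\<lambda>t. f (R * cis t)) has_integral 2 * pi * f 0) {0..2 * pi}"
  using circle_Cauchy_formula[OF assms(1-3), of 0] assms(4) by simp

lemma has_integral_Re:
  "(f has_integral I) S \<Longrightarrow> ((\<lambda>t. Re (f t)) has_integral Re I) S"
  using has_integral_linear[OF _ bounded_linear_Re] by (simp add: o_def)

text \<open>On \<open>|z| = R\<close> the modulus \<open>|z - s|\<close> equals
  \<open>R * |1 - cnj s * z / R ^ 2|\<close>, which has no zero in the closed disc because the
  reflected point lies outside. Its logarithm is therefore harmonic there, and the mean is the value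
  \<open>ln R\<close> at the origin.\<close>

lemma circle_mean_ln_norm:
  assumes "norm s < R"
  shows "((\<lambda>t. ln (norm (R * cis t - s))) has_integral 2 * pi * ln R) {0..2 * pi}"
proof -
  have R: "R > 0" using assms norm_ge_zero[of s] by linarith
  \<comment> \<open>A positive real part keeps the argument of \<open>Ln\<close> off the branch
    cut.\<close>
  define A where "A = {z. Re (1 - cnj s * z / R ^ 2) > 0}"
  define f where "f = (\<lambda>z. Ln (1 - cnj s * z / R ^ 2))"
  have "open A" unfolding A_def
    by (intro open_Collect_less continuous_intros) (use R in auto)
  have hol: "f holomorphic_on A" unfolding f_def A_def
    by (intro holomorphic_intros) (use R in \<open>auto simp: complex_nonpos_Reals_iff\<close>)
  have *: "norm (cnj s * z / R ^ 2) < 1" if "norm z \<le> R" for z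
  proof -
    have "norm s * norm z \<le> norm s * R" using that by (intro mult_left_mono) auto
    also have "\<dots> < R * R" using assms R by simp
    finally show ?thesis using R by (simp add: norm_mult norm_divide norm_power power2_eq_square)
  qed
  have pos: "Re (1 - cnj s * z / R ^ 2) > 0" if "norm z \<le> R" for z
    using *[OF that] complex_Re_le_cmod[of "cnj s * z / R ^ 2"] by simp
  have sub: "cball 0 R \<subseteq> A" unfolding A_def using pos by auto
  have "((\<lambda>t. ln R + Re (f (R * cis t))) has_integral ln R * (2 * pi) + Re (2 * pi * f 0)) {0..2 * pi}"
    using has_integral_add[OF has_integral_const_real[of "ln R" 0 "2*pi"]
        has_integral_Re[OF circle_mean_value[OF hol \<open>open A\<close> sub R]]] by (simp add: mult.commute)
  also have "ln R * (2 * pi) + Re (2 * pi * f 0) = 2 * pi * ln R"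
    by (simp add: f_def)
  also have "(\<lambda>t. ln R + Re (f (R * cis t))) = (\<lambda>t. ln (norm (R * cis t - s)))"
  proof
    fix t
    have nz: "1 - cnj s * (R * cis t) / R ^ 2 \<noteq> 0"
    proof
      assume eq: "1 - cnj s * (R * cis t) / R ^ 2 = 0"
      have "Re (1 - cnj s * (R * cis t) / R ^ 2) > 0"
        by (rule pos) (use R in \<open>simp add: norm_mult\<close>)
      hence "Re 0 > 0" by (simp only: eq)
      thus False by simp
    qed
    \<comment> \<open>Conjugating and multiplying by the unimodular \<open>cis t\<close> turns
      \<open>R * cis t\<close> into the constant \<open>R\<close>.\<close>
    have "norm (R * cis t - s) = norm (cnj (R * cis t - s) * cis t)"
      by (simp only: norm_mult complex_mod_cnj norm_cis mult_1_right)
    also have "cnj (R * cis t - s) * cis t = R * (1 - cnj s * (R * cis t) / R ^ 2)"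
      using R by (simp add: field_simps power2_eq_square cis_cnj cis_mult)
    also have "norm \<dots> = R * norm (1 - cnj s * (R * cis t) / R ^ 2)"
      using R by (simp only: norm_mult norm_of_real)
    finally show "ln R + Re (f (R * cis t)) = ln (norm (R * cis t - s))"
      unfolding f_def using nz R by (simp add: ln_mult)
  qed
  finally show ?thesis .
qed

text \<open>Cauchy's formula writes \<open>h z - h 0\<close> as a mean of \<open>h\<close> against
  the kernel \<open>k\<close>. The mean of \<open>cnj h\<close> against \<open>k\<close> vanishes,
  so adding it replaces \<open>h\<close> by \<open>2 * Re h\<close>; no control of the imaginary
  part is required.\<close>

lemma Schwarz_integral_bound:
  fixes h :: "complex \<Rightarrow> complex"
  assumes hol: "h holomorphic_on A" and "open A" and sub: "cball 0 R \<subseteq> A" and z: "norm z < R"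
    and int: "((\<lambda>t. \<bar>Re (h (R * cis t))\<bar>) has_integral J) {0..2 * pi}"
  shows "norm (h z - h 0) \<le> norm z / (pi * (R - norm z)) * J"
proof -
  have R: "R > 0" using z norm_ge_zero[of z] by linarith
  define k where "k = (\<lambda>t. z / (R * cis t - z))"
  have nz: "R * cis t - z \<noteq> 0" for t
  proof
    assume "R * cis t - z = 0"
    hence "norm z = norm (R * cis t)" by simp
    also have "\<dots> = R" using R by (simp add: norm_mult)
    finally show False using z by simp
  qed
  have 1: "((\<lambda>t. h (R * cis t) * k t) has_integral 2 * pi * (h z - h 0)) {0..2 * pi}"
  proof -
    have "((\<lambda>t. h (R * cis t) * (R * cis t) / (R * cis t - z) - h (R * cis t)) has_integral
         2 * pi * h z - 2 * pi * h 0) {0..2 * pi}"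
      by (intro has_integral_diff circle_Cauchy_formula[OF hol] circle_mean_value[OF hol] assms R)
    also have "(\<lambda>t. h (R * cis t) * (R * cis t) / (R * cis t - z) - h (R * cis t)) =
       (\<lambda>t. h (R * cis t) * k t)"
      unfolding k_def using nz by (intro ext) (simp add: field_simps)
    finally show ?thesis by (simp add: algebra_simps)
  qed
  \<comment> \<open>The conjugate of the kernel is the boundary value of a holomorphic function vanishing at 0.\<close>
  have 2: "((\<lambda>t. cnj (h (R * cis t)) * k t) has_integral 0) {0..2 * pi}"
  proof -
    define B where "B = A \<inter> {w. Re ((of_real R :: complex) ^ 2 - cnj z * w) > 0}"
    define f where "f = (\<lambda>w. h w * (cnj z * w / ((of_real R :: complex) ^ 2 - cnj z * w)))"
    have "open B" unfolding B_def
      by (intro open_Int \<open>open A\<close> open_Collect_less continuous_intros)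
    have nzB: "(of_real R :: complex) ^ 2 - cnj z * w \<noteq> 0" if "w \<in> B" for w :: complex
    proof
      assume eq: "(of_real R :: complex) ^ 2 - cnj z * w = 0"
      have "Re ((of_real R :: complex) ^ 2 - cnj z * w) > 0" using that by (simp add: B_def)
      hence "Re 0 > 0" by (simp only: eq)
      thus False by simp
    qed
    have "f holomorphic_on B" unfolding f_def
      by (intro holomorphic_intros holomorphic_on_subset[OF hol] nzB) (auto simp: B_def)
    moreover have "cball 0 R \<subseteq> B"
    proof
      fix w :: complex assume w: "w \<in> cball 0 R"
      have "Re (cnj z * w) \<le> norm z * norm w"
        using complex_Re_le_cmod[of "cnj z * w"] by (simp add: norm_mult)
      also have "\<dots> \<le> norm z * R" using w by (intro mult_left_mono) auto
      also have "\<dots> < R * R" using z R by simp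
      finally show "w \<in> B" using w sub
        by (auto simp: B_def power2_eq_square simp flip: of_real_mult)
    qed
    ultimately have "((\<lambda>t. f (R * cis t)) has_integral 2 * pi * f 0) {0..2 * pi}"
      using \<open>open B\<close> R by (intro circle_mean_value)
    from has_integral_cnj[THEN iffD2, OF this]
    have "((\<lambda>t. cnj (f (R * cis t))) has_integral 0) {0..2 * pi}"
      by (simp add: fun_cong[OF f_def, of 0] o_def)
    also have "(\<lambda>t. cnj (f (R * cis t))) = (\<lambda>t. cnj (h (R * cis t)) * k t)"
    proof
      fix t
      have "cnj (cnj z * (R * cis t) / (R ^ 2 - cnj z * (R * cis t))) = z * R * cis (-t) / (R ^ 2 - z * R * cis (-t))"
        by (simp add: cis_cnj mult.assoc)
      also have "\<dots> = (z * R * cis (-t)) * cis t / ((R ^ 2 - z * R * cis (-t)) * cis t)"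
        by simp
      also have "(z * R * cis (-t)) * cis t = R * z" by (simp add: cis_mult mult.assoc)
      also have "(R ^ 2 - z * R * cis (-t)) * cis t = R * (R * cis t - z)"
        by (simp add: cis_mult mult.assoc algebra_simps power2_eq_square)
      also have "R * z / (R * (R * cis t - z)) = k t" using R by (simp add: k_def)
      finally show "cnj (f (R * cis t)) = cnj (h (R * cis t)) * k t"
        unfolding f_def by (subst complex_cnj_mult) (simp only: of_real_power)
    qed
    finally show ?thesis .
  qed
  have 3: "((\<lambda>t. 2 * of_real (Re (h (R * cis t))) * k t) has_integral 2 * pi * (h z - h 0)) {0..2 * pi}"
    using has_integral_add[OF 1 2]
    by (simp only: distrib_right[symmetric] complex_add_cnj) simp
  have k: "norm (k t) \<le> norm z / (R - norm z)" for t
  proof -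
    have "R - norm z \<le> norm (R * cis t - z)"
      using norm_triangle_ineq2[of "R * cis t" z] R by (simp add: norm_mult)
    thus ?thesis unfolding k_def norm_divide using z by (intro divide_left_mono) (auto intro!: mult_pos_pos)
  qed
  have 4: "((\<lambda>t. 2 * (norm z / (R - norm z)) * \<bar>Re (h (R * cis t))\<bar>) has_integral
            2 * (norm z / (R - norm z)) * J) {0..2 * pi}"
    by (intro has_integral_mult_right int)
  have "norm (integral {0..2*pi} (\<lambda>t. 2 * of_real (Re (h (R * cis t))) * k t)) \<le>
     integral {0..2*pi} (\<lambda>t. 2 * (norm z / (R - norm z)) * \<bar>Re (h (R * cis t))\<bar>)"
  proof (rule integral_norm_bound_integral)
    fix t 
    show "norm (2 * of_real (Re (h (R * cis t))) * k t) \<le> 2 * (norm z / (R - norm z)) * \<bar>Re (h (R * cis t))\<bar>"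
      using mult_left_mono[OF k[of t], of "2 * \<bar>Re (h (R * cis t))\<bar>"]
      by (simp add: norm_mult mult_ac)
  qed (use 3 4 in \<open>auto simp: integrable_on_def\<close>)
  hence "norm (2 * pi * (h z - h 0)) \<le> 2 * (norm z / (R - norm z)) * J"
    unfolding integral_unique[OF 3] integral_unique[OF 4] .
  hence "2 * pi * norm (h z - h 0) \<le> 2 * (norm z / (R - norm z)) * J"
    by (simp add: norm_mult)
  thus ?thesis using z by (simp add: field_simps)
qed

subsection \<open>Means of logarithms over circles\<close>

lemma log_plus_nonneg: "0 \<le> log_plus x"
  by (simp add: log_plus_def)

lemma log_plus_mono: "x \<le> y \<Longrightarrow> log_plus x \<le> log_plus y"
  by (auto simp: log_plus_def)

lemma log_plus_le_ln: "x \<le> y \<Longrightarrow> 0 \<le> y \<Longrightarrow> log_plus x \<le> ln (1 + y)"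
  by (auto simp: log_plus_def)

lemma log_plus_mult_le:
  assumes "0 \<le> x" "0 \<le> y"
  shows "log_plus (x * y) \<le> log_plus x + log_plus y"
proof -
  have "x * y \<le> max 1 x * max 1 y" using assms by (intro mult_mono) auto
  moreover have "1 * 1 \<le> max 1 x * max 1 y" by (intro mult_mono) auto
  ultimately have "ln (max 1 (x * y)) \<le> ln (max 1 x * max 1 y)"
    by (subst ln_le_cancel_iff) auto
  also have "\<dots> = ln (max 1 x) + ln (max 1 y)" by (rule ln_mult_pos) auto
  finally show ?thesis by (simp add: log_plus_def)
qed

lemma log_plus_add_le:
  assumes "0 \<le> x" "0 \<le> y"
  shows "log_plus (x + y) \<le> ln 2 + log_plus x + log_plus y"
proof -
  have "1 * 1 \<le> max 1 x * max 1 y" "x * 1 \<le> max 1 x * max 1 y" "1 * y \<le> max 1 x * max 1 y"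
    using assms by (intro mult_mono; simp)+
  hence "max 1 (x + y) \<le> 2 * (max 1 x * max 1 y)" by linarith
  hence "ln (max 1 (x + y)) \<le> ln (2 * (max 1 x * max 1 y))" by (subst ln_le_cancel_iff) auto
  also have "\<dots> = ln 2 + (ln (max 1 x) + ln (max 1 y))"
    by (subst ln_mult_pos, simp, simp, subst ln_mult_pos) auto
  finally show ?thesis by (simp add: log_plus_def)
qed

lemma log_plus_sum_le:
  assumes "finite A" "\<And>x. x \<in> A \<Longrightarrow> 0 \<le> f x"
  shows "log_plus (sum f A) \<le> card A * ln 2 + (\<Sum>x\<in>A. log_plus (f x))"
  using assms
proof (induction A)
  case empty
  thus ?case by (simp add: log_plus_def)
next
  case (insert a A)
  thus ?case using log_plus_add_le[of "f a" "sum f A"]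
    by (simp add: sum_nonneg algebra_simps)
qed

lemma log_plus_prod_le:
  assumes "\<And>x. x \<in> A \<Longrightarrow> 0 \<le> f x"
  shows "log_plus (prod f A) \<le> (\<Sum>x\<in>A. log_plus (f x))"
  using assms
proof (induction A rule: infinite_finite_induct)
  case (insert a A)
  thus ?case using log_plus_mult_le[of "f a" "prod f A"] by (simp add: prod_nonneg)
qed (auto simp: log_plus_def)

lemma log_plus_power_le:
  assumes "0 \<le> x"
  shows "log_plus (x ^ n) \<le> n * log_plus x"
  using log_plus_prod_le[of "{..<n}" "\<lambda>_. x"] assms by simp

text \<open>Including both \<open>x\<close> and its inverse gives one bound for positive and
  negative exponents, that is, for zeros and poles alike.\<close>

lemma log_plus_power_int_le:
  assumes "0 \<le> x"
  shows "log_plus (x powi n) \<le> of_int \<bar>n\<bar> * (log_plus x + log_plus (inverse x))"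
proof (cases "n \<ge> 0")
  case True
  have "log_plus (x powi n) \<le> of_int \<bar>n\<bar> * log_plus x"
    using log_plus_power_le[OF assms, of "nat n"] True by (simp add: power_int_def)
  also have "\<dots> \<le> of_int \<bar>n\<bar> * (log_plus x + log_plus (inverse x))"
    by (intro mult_left_mono) (auto simp: log_plus_nonneg)
  finally show ?thesis .
next
  case False
  have "log_plus (x powi n) \<le> of_int \<bar>n\<bar> * log_plus (inverse x)"
    using log_plus_power_le[of "inverse x" "nat (-n)"] False assms by (simp add: power_int_def)
  also have "\<dots> \<le> of_int \<bar>n\<bar> * (log_plus x + log_plus (inverse x))"
    by (intro mult_left_mono) (auto simp: log_plus_nonneg)
  finally show ?thesis .
qed

lemma log_plus_norm_exp_le:
  fixes z :: complex
  shows "log_plus (norm (exp z)) \<le> norm z"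
proof -
  have "max 1 (exp (Re z)) \<le> exp \<bar>Re z\<bar>" by auto
  hence "ln (max 1 (exp (Re z))) \<le> ln (exp \<bar>Re z\<bar>)" by (subst ln_le_cancel_iff) auto
  thus ?thesis using abs_Re_le_cmod[of z] by (simp add: log_plus_def)
qed

lemma abs_ln_eq: "x > 0 \<Longrightarrow> \<bar>ln x\<bar> = 2 * log_plus x - ln x"
  by (auto simp: log_plus_def max_def)

lemma ln_le_log_plus: "x > 0 \<Longrightarrow> ln x \<le> log_plus x"
  by (auto simp: log_plus_def max_def)

lemma proximity_nonneg: "0 \<le> proximity f r"
proof -
  \<comment> \<open>A non-integrable integrand is harmless: its \<open>integral\<close> is 0 by
    convention.\<close>
  have "0 \<le> integral {0..2 * pi} (\<lambda>\<theta>. log_plus (norm (f (of_real r * cis \<theta>))))"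
    by (cases "(\<lambda>\<theta>. log_plus (norm (f (of_real r * cis \<theta>)))) integrable_on {0..2 * pi}")
       (auto intro!: integral_nonneg log_plus_nonneg simp: not_integrable_integral)
  thus ?thesis by (simp add: proximity_def)
qed

section \<open>Upper integrals over the circle\<close>

text \<open>Asserting a bound on an upper integral makes no measurability demand on \<open>f\<close>.\<close>

definition circle_upper_le :: "(real \<Rightarrow> real) \<Rightarrow> real \<Rightarrow> bool" where
  "circle_upper_le f M \<longleftrightarrow> (\<exists>F N. finite N \<and> F integrable_on {0..2 * pi} \<and>
      integral {0..2 * pi} F \<le> M \<and> (\<forall>t\<in>{0..2 * pi} - N. f t \<le> F t))"

lemma circle_upper_leI:
  assumes "finite N" "(F has_integral I) {0..2 * pi}" "I \<le> M"
    and "\<And>t. 0 \<le> t \<Longrightarrow> t \<le> 2 * pi \<Longrightarrow> t \<notin> N \<Longrightarrow> f t \<le> F t"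
  shows "circle_upper_le f M"
  unfolding circle_upper_le_def using assms
  by (intro exI[of _ F] exI[of _ N]) (auto simp: integrable_on_def integral_unique)

lemma circle_upper_le_mono:
  assumes "circle_upper_le f M" "finite N" "M \<le> M'"
    and "\<And>t. t \<in> {0..2 * pi} - N \<Longrightarrow> g t \<le> f t"
  shows "circle_upper_le g M'"
proof -
  obtain F N' where "finite N'" "F integrable_on {0..2 * pi}" "integral {0..2 * pi} F \<le> M"
    "\<forall>t\<in>{0..2 * pi} - N'. f t \<le> F t"
    using assms(1) unfolding circle_upper_le_def by auto
  moreover from this(4) assms(4) have "\<forall>t\<in>{0..2 * pi} - (N \<union> N'). g t \<le> F t"
    by (meson DiffD1 DiffD2 DiffI UnI1 UnI2 order_trans)
  ultimately show ?thesis unfolding circle_upper_le_def using assms(2,3)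
    by (intro exI[of _ F] exI[of _ "N \<union> N'"]) auto
qed

lemma circle_upper_le_const: "circle_upper_le (\<lambda>_. b) (2 * pi * b)"
  by (rule circle_upper_leI[OF _ has_integral_const_real[of b]]) auto

lemma circle_upper_le_add:
  assumes "circle_upper_le f M" "circle_upper_le g M'"
  shows "circle_upper_le (\<lambda>t. f t + g t) (M + M')"
proof -
  obtain F N where "finite N" "F integrable_on {0..2 * pi}" "integral {0..2 * pi} F \<le> M"
    "\<forall>t\<in>{0..2 * pi} - N. f t \<le> F t"
    using assms(1) unfolding circle_upper_le_def by auto
  moreover obtain G N' where "finite N'" "G integrable_on {0..2 * pi}" "integral {0..2 * pi} G \<le> M'"
    "\<forall>t\<in>{0..2 * pi} - N'. g t \<le> G t"
    using assms(2) unfolding circle_upper_le_def by auto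
  ultimately show ?thesis unfolding circle_upper_le_def
    by (intro exI[of _ "\<lambda>t. F t + G t"] exI[of _ "N \<union> N'"])
       (auto intro!: integrable_add add_mono simp: integral_add)
qed

lemma circle_upper_le_cmult:
  assumes "circle_upper_le f M" "b \<ge> 0"
  shows "circle_upper_le (\<lambda>t. b * f t) (b * M)"
proof -
  obtain F N where *: "finite N" "F integrable_on {0..2 * pi}" "integral {0..2 * pi} F \<le> M"
    "\<forall>t\<in>{0..2 * pi} - N. f t \<le> F t"
    using assms(1) unfolding circle_upper_le_def by auto
  have "(\<lambda>t. b * F t) integrable_on {0..2 * pi}" using *(2) by (rule integrable_on_mult_right)
  with * show ?thesis unfolding circle_upper_le_def using assms(2)
    by (intro exI[of _ "\<lambda>t. b * F t"] exI[of _ N]) (auto intro!: mult_left_mono)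
qed

lemma circle_upper_le_sum:
  assumes "\<And>x. x \<in> A \<Longrightarrow> circle_upper_le (f x) (M x)"
  shows "circle_upper_le (\<lambda>t. \<Sum>x\<in>A. f x t) (\<Sum>x\<in>A. M x)"
  using assms
proof (induction A rule: infinite_finite_induct)
  case (insert a A)
  thus ?case using circle_upper_le_add[of "f a" "M a"] by simp
qed (use circle_upper_le_const[of 0] in auto)

text \<open>If \<open>f\<close> is not integrable, its \<open>integral\<close> is the default 0, and
  \<open>M\<close> is still an upper bound because the majorant of a nonnegative function has a
  nonnegative integral.\<close>

lemma circle_upper_le_imp_integral_le:
  assumes "circle_upper_le f M" "\<And>t. 0 \<le> f t"
  shows "integral {0..2 * pi} f \<le> M"
proof -
  obtain F N where F: "finite N" "F integrable_on {0..2 * pi}" "integral {0..2 * pi} F \<le> M"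
    "\<And>t. t \<in> {0..2 * pi} - N \<Longrightarrow> f t \<le> F t"
    using assms(1) unfolding circle_upper_le_def by auto
  \<comment> \<open>Changing the majorant at the finitely many exceptional points keeps its integral
    and makes it valid everywhere.\<close>
  define G where "G = (\<lambda>t. if t \<in> N then f t else F t)"
  have G: "G integrable_on {0..2 * pi}" "integral {0..2 * pi} G = integral {0..2 * pi} F"
    using F(1,2) unfolding G_def
    by (auto intro!: integrable_spike_finite[of N _ _ F] integral_spike[of N] negligible_finite)
  have le: "f t \<le> G t" if "t \<in> {0..2 * pi}" for t
    using that F(4) by (auto simp: G_def)
  show ?thesis
  proof (cases "f integrable_on {0..2 * pi}")
    case True
    thus ?thesis using integral_le[OF True G(1) le] G(2) F(3) by simp
  next
    case False
    have "0 \<le> integral {0..2 * pi} G"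
      by (intro integral_nonneg G) (use le assms(2) order_trans in blast)
    thus ?thesis using not_integrable_integral[OF False] G(2) F(3) by simp
  qed
qed

section \<open>Uniform bounds for logarithmic singularities on circles\<close>

text \<open>The real \<open>sqrt\<close> is extended to negative arguments as an odd function, so
  \<open>2 * sqrt (t - b)\<close> is a continuous antiderivative on both sides of
  \<open>b\<close>.\<close>

lemma has_integral_inverse_sqrt_abs:
  assumes "x \<le> y"
  shows "((\<lambda>t. inverse (sqrt \<bar>t - b\<bar>)) has_integral 2 * sqrt (y - b) - 2 * sqrt (x - b)) {x..y}"
proof (rule fundamental_theorem_of_calculus_interior_strong[of "{b}"])
  fix t assume "t \<in> {x<..<y} - {b}"
  hence "t - b \<noteq> 0" by auto
  hence "(sqrt has_real_derivative inverse (sqrt \<bar>t - b\<bar>) / 2) (at (t - b))"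
    using real_sqrt_minus[of "t - b"] by (intro DERIV_real_sqrt_generic) (auto simp: abs_if)
  moreover have "((\<lambda>t. t - b) has_real_derivative 1) (at t)"
    by (auto intro!: derivative_eq_intros)
  ultimately have "((\<lambda>t. sqrt (t - b)) has_real_derivative inverse (sqrt \<bar>t - b\<bar>) / 2 * 1) (at t)"
    by (rule DERIV_chain2)
  from DERIV_cmult[OF this, of 2]
  show "((\<lambda>t. 2 * sqrt (t - b)) has_vector_derivative inverse (sqrt \<bar>t - b\<bar>)) (at t)"
    by (simp add: has_real_derivative_iff_has_vector_derivative)
qed (use assms in \<open>auto intro!: continuous_intros\<close>)

text \<open>A crude Jordan inequality. Up to \<open>pi / 3\<close> the derivative of
  \<open>sin x - x / 2\<close> is nonnegative; beyond that \<open>sin x \<ge> 1 / 2\<close>, while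
  \<open>x / 4 < 1 / 2\<close>.\<close>

lemma sin_ge_quarter:
  assumes "0 \<le> x" "x \<le> pi / 2"
  shows "x / 4 \<le> sin x"
proof (cases "x \<le> pi / 3")
  case True
  have "sin 0 - 0 / 2 \<le> sin x - x / 2"
  proof (rule DERIV_nonneg_imp_nondecreasing[OF assms(1)])
    fix y assume y: "0 \<le> y" "y \<le> x"
    have "cos (pi / 3) \<le> cos y"
      using y True by (intro cos_monotone_0_pi_le) auto
    thus "\<exists>D. ((\<lambda>x. sin x - x / 2) has_real_derivative D) (at y) \<and> 0 \<le> D"
      by (intro exI[of _ "cos y - 1 / 2"]) (auto intro!: derivative_eq_intros simp: cos_60)
  qed
  thus ?thesis using assms by simp
next
  case False
  have "sin (pi / 6) \<le> sin x"
    using False assms by (intro sin_monotone_2pi_le) auto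
  thus ?thesis using assms pi_less_4 by (simp add: sin_30)
qed

lemma norm_cis_diff: "norm (cis t - cis u) = 2 * \<bar>sin ((t - u) / 2)\<bar>"
proof -
  define p d where "p = (t + u) / 2" and "d = (t - u) / 2"
  have "cis (p + d) - cis (p - d) = cis p * (2 * \<i> * of_real (sin d))"
    by (auto simp: complex_eq_iff cos_add cos_diff sin_add sin_diff algebra_simps)
  also have "p + d = t" by (simp add: p_def d_def field_simps)
  also have "p - d = u" by (simp add: p_def d_def field_simps)
  finally have "cis t - cis u = cis p * (2 * \<i> * of_real (sin d))" .
  thus ?thesis by (simp add: norm_mult d_def)
qed

text \<open>The chord from \<open>cis u\<close> to \<open>cis t\<close> is short also when
  \<open>t - u\<close> is near \<open>2 * pi\<close> or \<open>- 2 * pi\<close>; the two shifted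
  terms account for this wrap-around.\<close>

lemma inverse_sqrt_norm_cis_diff_le:
  assumes "0 \<le> t" "t \<le> 2 * pi" "0 \<le> u" "u \<le> 2 * pi" "t \<notin> {u, u + 2 * pi, u - 2 * pi}"
  shows "0 < norm (cis t - cis u)" (is ?A)
    and "inverse (sqrt (norm (cis t - cis u))) \<le> 2 * (inverse (sqrt \<bar>t - u\<bar>) +
           inverse (sqrt \<bar>t - (u + 2 * pi)\<bar>) + inverse (sqrt \<bar>t - (u - 2 * pi)\<bar>))" (is ?B)
proof -
  define d where "d = \<bar>t - u\<bar> / 2"
  have d: "0 < d" "d < pi" using assms by (auto simp: d_def abs_if)
  have N: "norm (cis t - cis u) = 2 * sin d"
  proof -
    have "sin d \<ge> 0" using d by (intro sin_ge_zero) auto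
    moreover have "\<bar>sin ((t - u) / 2)\<bar> = \<bar>sin d\<bar>"
      using sin_minus[of "(t - u) / 2"] by (cases "t \<ge> u") (auto simp: d_def minus_divide_left)
    ultimately show ?thesis by (simp add: norm_cis_diff)
  qed
  define f :: "real \<Rightarrow> real" where "f = (\<lambda>y. inverse (sqrt \<bar>y\<bar>))"
  have *: "inverse (sqrt (2 * sin d)) \<le> 2 * f y" if "y \<noteq> 0" "\<bar>y\<bar> / 4 \<le> 2 * sin d" for y
  proof -
    have "sqrt \<bar>y\<bar> / 2 = sqrt (\<bar>y\<bar> / 4)" by (simp add: real_sqrt_divide)
    also have "\<dots> \<le> sqrt (2 * sin d)" using that(2) by simp
    finally have "inverse (sqrt (2 * sin d)) \<le> inverse (sqrt \<bar>y\<bar> / 2)"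
      using that(1) by (intro le_imp_inverse_le) auto
    thus ?thesis by (simp add: field_simps f_def)
  qed
  have nn: "0 \<le> f z" for z by (simp add: f_def)
  have "0 < sin d" using d by (intro sin_gt_zero)
  define L where "L = inverse (sqrt (2 * sin d))"
  have "L \<le> 2 * (f (t - u) + f (t - (u + 2 * pi)) + f (t - (u - 2 * pi)))"
  proof (cases "d \<le> pi / 2")
    case True
    have "d / 4 \<le> sin d" using sin_ge_quarter[of d] d True by simp
    hence "\<bar>t - u\<bar> / 4 \<le> 2 * sin d" "t - u \<noteq> 0" using d by (auto simp: d_def)
    from *[OF this(2,1), folded L_def] show ?thesis using nn[of "t - (u + 2 * pi)"] nn[of "t - (u - 2 * pi)"] by (simp add: distrib_left)
  next
    case False
    have D: "(pi - d) / 4 \<le> sin d" using sin_ge_quarter[of "pi - d"] d False by simp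
    show ?thesis
    proof (cases "t \<ge> u")
      case True
      hence "\<bar>t - (u + 2 * pi)\<bar> = 2 * (pi - d)" using assms by (auto simp: d_def abs_if field_simps)
      hence "\<bar>t - (u + 2 * pi)\<bar> / 4 \<le> 2 * sin d" "t - (u + 2 * pi) \<noteq> 0" using d D by auto
      from *[OF this(2,1), folded L_def] show ?thesis using nn[of "t - u"] nn[of "t - (u - 2 * pi)"] by (simp add: distrib_left)
    next
      case False
      hence "\<bar>t - (u - 2 * pi)\<bar> = 2 * (pi - d)" using assms by (auto simp: d_def abs_if field_simps)
      hence "\<bar>t - (u - 2 * pi)\<bar> / 4 \<le> 2 * sin d" "t - (u - 2 * pi) \<noteq> 0" using d D by auto
      from *[OF this(2,1), folded L_def] show ?thesis using nn[of "t - u"] nn[of "t - (u + 2 * pi)"] by (simp add: distrib_left)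
    qed
  qed
  with \<open>0 < sin d\<close> show ?A ?B by (simp_all add: N f_def L_def)
qed

text \<open>After scaling, the distance to \<open>w\<close> is at least a constant times
  \<open>max r |w|\<close> times the chord between \<open>cis t\<close> and the direction of
  \<open>w\<close>. What remains is a logarithm of the inverse chord, whose integral is bounded
  independently of \<open>r\<close> and \<open>w\<close>.\<close>

lemma circle_log_singularity_bound:
  assumes "0 \<le> A" "0 \<le> B"
  obtains K where "\<And>r w. r > 0 \<Longrightarrow>
    circle_upper_le (\<lambda>t. ln (1 + A + B * (max r (norm w) / norm (r * cis t - w)))) K"
proof
  define c1 c2 where "c1 = 2 * sqrt (1 + A)" and "c2 = 8 * sqrt B"
  \<comment> \<open>Each of the three inverse square roots integrates to
    \<open>2 * sqrt (2 * pi - b) + 2 * sqrt b\<close> with odd \<open>sqrt\<close>, and both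
    arguments are at most \<open>4 * pi\<close>.\<close>
  define K where "K = c1 * (2 * pi) + c2 * (3 * (4 * sqrt (4 * pi)))"
  fix r :: real and w :: complex assume r: "r > 0"
  define u where "u = Arg2pi w"
  have u: "0 \<le> u" "u \<le> 2 * pi" using Arg2pi[of w] by (auto simp: u_def)
  have w: "norm w * cis u = w"
    using Arg2pi[of w] unfolding u_def is_Arg_def cis_conv_exp by simp
  define F where "F = (\<lambda>t. c1 + c2 * (inverse (sqrt \<bar>t - u\<bar>) +
           inverse (sqrt \<bar>t - (u + 2 * pi)\<bar>) + inverse (sqrt \<bar>t - (u - 2 * pi)\<bar>)))"
  define J where "J = (\<lambda>b. 2 * sqrt (2 * pi - b) - 2 * sqrt (0 - b))"
  have F: "(F has_integral (c1 * (2 * pi) + c2 * (J u + J (u + 2 * pi) + J (u - 2 * pi)))) {0..2 * pi}"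
    unfolding F_def J_def using has_integral_const_real[of c1 0 "2 * pi"]
    by (intro has_integral_add has_integral_mult_right has_integral_inverse_sqrt_abs)
       (auto simp: mult.commute)
  have J: "J b \<le> 4 * sqrt (4 * pi)" if "- 2 * pi \<le> b" "b \<le> 4 * pi" for b
  proof -
    have "sqrt (2 * pi - b) \<le> sqrt (4 * pi)" "sqrt (b - 0) \<le> sqrt (4 * pi)"
      using that by (auto simp del: real_sqrt_mult)
    moreover have "- sqrt (0 - b) = sqrt (b - 0)" by (simp add: real_sqrt_minus)
    ultimately show ?thesis unfolding J_def by linarith
  qed
  have c2: "c2 \<ge> 0" using assms by (simp add: c2_def)
  have "J u + J (u + 2 * pi) + J (u - 2 * pi) \<le> 3 * (4 * sqrt (4 * pi))"
    using J[of u] J[of "u + 2 * pi"] J[of "u - 2 * pi"] u pi_gt_zero by linarith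
  hence le: "c1 * (2 * pi) + c2 * (J u + J (u + 2 * pi) + J (u - 2 * pi)) \<le> K"
    unfolding K_def using c2 by (intro add_left_mono mult_left_mono)
  show "circle_upper_le (\<lambda>t. ln (1 + A + B * (max r (norm w) / norm (r * cis t - w)))) K"
  proof (rule circle_upper_leI[OF _ F le])
    show "finite {u, u + 2 * pi, u - 2 * pi}" by simp
    fix t assume t: "0 \<le> t" "t \<le> 2 * pi" "t \<notin> {u, u + 2 * pi, u - 2 * pi}"
    define D where "D = norm (cis t - cis u)"
    define m where "m = norm (r * cis t - w)"
    note D = inverse_sqrt_norm_cis_diff_le[OF t(1,2) u(1,2) t(3), folded D_def]
    have D2: "D \<le> 2" using norm_triangle_ineq4[of "cis t" "cis u"] by (simp add: D_def)
    have m1: "\<bar>r - norm w\<bar> \<le> m"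
      using norm_triangle_ineq3[of "r * cis t" w] r by (simp add: m_def norm_mult)
    have "r * D = norm (r * cis t - r * cis u)"
      using r unfolding D_def by (simp add: norm_mult flip: right_diff_distrib)
    also have "r * cis t - r * cis u = (r * cis t - w) + (norm w - r) * cis u"
      using w by (simp add: algebra_simps)
    also have "norm \<dots> \<le> m + \<bar>norm w - r\<bar>"
      unfolding m_def
      by (rule norm_triangle_le) (simp add: norm_mult flip: of_real_diff)
    finally have rD: "r * D \<le> 2 * m" using m1 by linarith
    \<comment> \<open>For \<open>|w| \<le> 2 * r\<close> this is \<open>r * D \<le> 2 * m\<close>.
      Otherwise \<open>m \<ge> |w| - r \<ge> |w| / 2\<close>, and \<open>D \<le> 2\<close>
      suffices.\<close>
    have "max r (norm w) * D \<le> 4 * m"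
    proof (cases "norm w \<le> 2 * r")
      case True
      hence "max r (norm w) * D \<le> 2 * r * D" using r D(1) by (intro mult_right_mono) auto
      thus ?thesis using rD by simp
    next
      case False
      hence "max r (norm w) * D \<le> norm w * 2" using r D(1) D2 by (intro mult_mono) auto
      thus ?thesis using False m1 r by linarith
    qed
    moreover have "m \<ge> 0" by (simp add: m_def)
    ultimately have "max r (norm w) / m \<le> 4 * inverse D"
      using D(1) by (cases "m = 0") (auto simp: field_simps)
    hence "B * (max r (norm w) / m) \<le> B * (4 * inverse D)"
      using assms by (intro mult_left_mono) auto
    moreover have nn: "0 \<le> B * (max r (norm w) / m)"
      using assms r \<open>m \<ge> 0\<close> by auto
    ultimately have "ln (1 + A + B * (max r (norm w) / m)) \<le> ln (1 + A + B * (4 * inverse D))"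
      using assms by (subst ln_le_cancel_iff) linarith+
    \<comment> \<open>Writing \<open>ln y = 2 * ln (sqrt y)\<close> trades the logarithm for a
      square root, whose singularity has an explicit antiderivative.\<close>
    also have "\<dots> \<le> 2 * sqrt (1 + A + B * (4 * inverse D))"
    proof -
      define y where "y = 1 + A + B * (4 * inverse D)"
      have "y > 0" using assms D(1) by (auto simp: y_def intro!: add_pos_nonneg)
      hence "ln y = 2 * ln (sqrt y)" by (simp add: ln_sqrt)
      also have "ln (sqrt y) \<le> sqrt y - 1" by (rule ln_le_minus_one) (simp add: \<open>y > 0\<close>)
      finally show ?thesis by (simp add: y_def)
    qed
    also have "\<dots> \<le> 2 * (sqrt (1 + A) + sqrt (B * (4 * inverse D)))"
      using assms D(1) by (intro mult_left_mono sqrt_add_le_add_sqrt) auto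
    also have "\<dots> = c1 + c2 / 2 * inverse (sqrt D)"
      by (simp add: c1_def c2_def real_sqrt_mult real_sqrt_inverse)
    also have "\<dots> \<le> F t"
      using mult_left_mono[OF D(2), of "c2 / 2"] c2 by (simp add: F_def algebra_simps)
    finally show "ln (1 + A + B * (max r (norm w) / norm (r * cis t - w))) \<le> F t"
      by (simp add: m_def)
  qed
qed

text \<open>Both quotients have the form \<open>O(1) + O(max r |w|) / |z - w|\<close>, where \<open>w\<close> is \<open>s\<close> for the first one and the
  preimage \<open>(s - b) / a\<close> for the second one.\<close>

lemma circle_log_ratio_bound:
  fixes a b :: complex
  assumes "a \<noteq> 0"
  obtains K where "\<And>(r::real) (s::complex). (1::real) \<le> r \<Longrightarrow> circle_upper_le
    (\<lambda>t. log_plus (norm ((a * (r * cis t) + b - s) / (r * cis t - s))) +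
         log_plus (inverse (norm ((a * (r * cis t) + b - s) / (r * cis t - s))))) K"
proof -
  define c where "c = norm (a - 1) + norm b"
  obtain K1 where K1: "\<And>r w. r > 0 \<Longrightarrow>
    circle_upper_le (\<lambda>t. ln (1 + norm a + c * (max r (norm w) / norm (r * cis t - w)))) K1"
    by (rule circle_log_singularity_bound[of "norm a" c]) (auto simp: c_def)
  obtain K2 where K2: "\<And>r w. r > 0 \<Longrightarrow>
    circle_upper_le (\<lambda>t. ln (1 + inverse (norm a) + c / norm a * (max r (norm w) / norm (r * cis t - w)))) K2"
    by (rule circle_log_singularity_bound[of "inverse (norm a)" "c / norm a"]) (auto simp: c_def)
  have *: "norm ((a - 1) * s + b) \<le> c * max r (norm s)" if "r \<ge> 1" for s and r :: real
  proof -
    have "norm ((a - 1) * s + b) \<le> norm (a - 1) * norm s + norm b * 1"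
      using norm_triangle_ineq[of "(a - 1) * s" b] by (simp add: norm_mult)
    also have "\<dots> \<le> norm (a - 1) * max r (norm s) + norm b * max r (norm s)"
      using that by (intro add_mono mult_left_mono) auto
    finally show ?thesis by (simp add: c_def algebra_simps)
  qed
  have nn: "0 \<le> max r (norm s) / norm z" if "r \<ge> 1" for r :: real and s z :: complex
    using that by auto
  have c: "c \<ge> 0" by (simp add: c_def)
  show ?thesis
  proof (rule that)
    fix r :: real and s :: complex assume r: "r \<ge> 1"
    define s' where "s' = (s - b) / a"
    have s': "s = a * s' + b" using assms by (simp add: s'_def)
    have 1: "log_plus (norm ((a * z + b - s) / (z - s))) \<le>
        ln (1 + norm a + c * (max r (norm s) / norm (z - s)))" for z
    proof (cases "z = s")
      case True
      thus ?thesis by (simp add: log_plus_def)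
    next
      case False
      have "(a * z + b - s) / (z - s) = a + ((a - 1) * s + b) / (z - s)"
        using False by (simp add: field_simps)
      also have "norm \<dots> \<le> norm a + norm ((a - 1) * s + b) / norm (z - s)"
        using norm_triangle_ineq by (simp add: norm_divide flip: norm_divide)
      also have "\<dots> \<le> norm a + c * max r (norm s) / norm (z - s)"
        using *[OF r] by (intro add_left_mono divide_right_mono) auto
      finally have "log_plus (norm ((a * z + b - s) / (z - s))) \<le>
          ln (1 + (norm a + c * (max r (norm s) / norm (z - s))))"
        using nn[OF r, of s "z - s"] c by (intro log_plus_le_ln add_nonneg_nonneg mult_nonneg_nonneg) auto
      thus ?thesis by (simp add: add.assoc)
    qed
    have 2: "log_plus (inverse (norm ((a * z + b - s) / (z - s)))) \<le>
        ln (1 + inverse (norm a) + c / norm a * (max r (norm s') / norm (z - s')))" for z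
    proof (cases "z = s'")
      \<comment> \<open>Here the ratio is 0, and \<open>inverse 0 = 0\<close> makes the left side
        vanish.\<close>
      case True
      thus ?thesis using s' by (simp add: log_plus_def)
    next
      case False
      have e1: "a * z + b - s = a * (z - s')" and e2: "z - s = (z - s') - ((a - 1) * s' + b)"
        using s' by (simp_all add: algebra_simps)
      have "inverse ((a * z + b - s) / (z - s)) = inverse a - ((a - 1) * s' + b) / (a * (z - s'))"
        unfolding e1 e2 using False assms by (simp add: field_simps)
      also have "norm \<dots> \<le> inverse (norm a) + norm ((a - 1) * s' + b) / norm (a * (z - s'))"
        using norm_triangle_ineq4[of "inverse a" "((a - 1) * s' + b) / (a * (z - s'))"]
        by (simp only: norm_divide norm_inverse)
      also have "\<dots> \<le> inverse (norm a) + c * max r (norm s') / norm (a * (z - s'))"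
        using *[OF r] by (intro add_left_mono divide_right_mono) auto
      also have "c * max r (norm s') / norm (a * (z - s')) = c / norm a * (max r (norm s') / norm (z - s'))"
        by (simp add: norm_mult)
      finally have "inverse (norm ((a * z + b - s) / (z - s))) \<le>
          inverse (norm a) + c / norm a * (max r (norm s') / norm (z - s'))"
        by (simp only: norm_inverse)
      hence "log_plus (inverse (norm ((a * z + b - s) / (z - s)))) \<le>
          ln (1 + (inverse (norm a) + c / norm a * (max r (norm s') / norm (z - s'))))"
        using nn[OF r, of s' "z - s'"] c
        by (intro log_plus_le_ln add_nonneg_nonneg mult_nonneg_nonneg) auto
      thus ?thesis by (simp add: add.assoc)
    qed
    show "circle_upper_le
      (\<lambda>t. log_plus (norm ((a * (r * cis t) + b - s) / (r * cis t - s))) +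
         log_plus (inverse (norm ((a * (r * cis t) + b - s) / (r * cis t - s))))) (K1 + K2)"
      by (rule circle_upper_le_mono[OF circle_upper_le_add[OF K1[of r s] K2[of r s']] finite.emptyI])
         (use r 1 2 in \<open>auto intro!: add_mono\<close>)
  qed
qed

subsection \<open>Factorization and Jensen's formula\<close>

text \<open>This turns order zero at a point into a nonvanishing analytic extension, the form needed
  for taking a holomorphic logarithm.\<close>

lemma remove_sings_zorder_0:
  assumes "f meromorphic_on {z}" "eventually (\<lambda>z. f z \<noteq> 0) (at z)" "zorder f z = 0"
  shows "remove_sings f analytic_on {z}" "remove_sings f z \<noteq> 0"
proof -
  have iso: "isolated_singularity_at f z" and ness: "not_essential f z"
    using assms(1) by (auto simp: meromorphic_at_iff)
  have np: "\<not> is_pole f z"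
    using isolated_pole_imp_neg_zorder[OF iso] assms(3) by auto
  show ana: "remove_sings f analytic_on {z}"
    using remove_sings_nicely_meromorphic[OF assms(1)] np iso
    by (intro nicely_meromorphic_on_imp_analytic_at[of _ "{z}"]) auto
  have "eventually (\<lambda>w. remove_sings f w = f w) (at z)"
    using iso by (rule eventually_remove_sings_eq_at)
  hence "eventually (\<lambda>w. remove_sings f w \<noteq> 0) (at z)"
    using assms(2) by eventually_elim auto
  hence "frequently (\<lambda>w. remove_sings f w \<noteq> 0) (at z)"
    by (intro eventually_frequently) auto
  thus "remove_sings f z \<noteq> 0"
    using zorder_eq_0_iff[OF ana] assms(3) iso by simp
qed

lemma zorder_linear: "zorder (\<lambda>w. w - s) z = (if z = s then 1 else 0)"
proof (cases "z = s")
  case True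
  have "zorder (\<lambda>w. w - s) s = 1"
    by (rule zorder_eqI[where S = UNIV and g = "\<lambda>_. 1"]) auto
  thus ?thesis using True by simp
qed (auto intro!: zorder_eq_0I analytic_intros)

lemma ln_power_int:
  assumes "x > 0"
  shows "ln (x powi n) = of_int n * ln (x :: real)"
  using assms by (cases "n \<ge> 0") (auto simp: power_int_def ln_realpow ln_inverse)

section \<open>The divisor of a meromorphic function and its factorization on discs\<close>

text \<open>The second assumption excludes functions vanishing off a sparse set, so that
  \<open>zorder\<close> is meaningful at every point.\<close>

locale plane_meromorphic =
  fixes g :: "complex \<Rightarrow> complex"
  assumes mero: "g meromorphic_on UNIV"
    and nz_cosparse: "\<forall>\<^sub>\<approx>z. g z \<noteq> 0"
begin

text \<open>Besides the zeros and poles, \<open>bad\<close> contains the points where the value of \<open>g\<close> is arbitrary.\<close>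

definition bad :: "complex set" where
  "bad = {z. \<not> g analytic_on {z} \<or> g z = 0}"

text \<open>Only \<open>zorder\<close> decides membership: a removable singularity with nonzero
  limit and a wrong value lies in \<open>bad\<close> but not here.\<close>

definition div_pts :: "real \<Rightarrow> complex set" where
  "div_pts r = {s. norm s \<le> r \<and> zorder g s \<noteq> 0}"

text \<open>On such a circle \<open>g\<close> is analytic and zero-free, so \<open>ln |g|\<close> is
  continuous there.\<close>

definition good :: "real \<Rightarrow> bool" where
  "good r \<longleftrightarrow> r > 0 \<and> (\<forall>z. norm z = r \<longrightarrow> z \<notin> bad)"

text \<open>This is the logarithm of the modulus of the leading Laurent coefficient at the origin, the constant
  term of Jensen's formula.\<close>

definition ln_lead :: real where
  "ln_lead = ln (norm (zor_poly g 0 0))"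

text \<open>In Nevanlinna's notation this is \<open>n(r, g) + n(r, 1/g)\<close>.\<close>

definition div_count :: "real \<Rightarrow> real" where
  "div_count r = (\<Sum>s\<in>div_pts r. real_of_int \<bar>zorder g s\<bar>)"

lemma mero_at: "g meromorphic_on {z}"
  using mero by (rule meromorphic_on_subset) auto

lemma sing_at: "isolated_singularity_at g z" "not_essential g z"
  using mero_at by (auto simp: meromorphic_at_iff)

lemma nz_at: "eventually (\<lambda>w. g w \<noteq> 0) (at z)"
  using nz_cosparse by (rule eventually_cosparse_imp_eventually_at) auto

lemma nz_at_frequently: "frequently (\<lambda>w. g w \<noteq> 0) (at z)"
  using nz_at by (rule eventually_frequently[rotated]) auto

lemma zorder_eq_0_if_not_bad: "z \<notin> bad \<Longrightarrow> zorder g z = 0"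
  unfolding bad_def by (auto intro: zorder_eq_0I)

lemma is_pole_iff_zorder: "is_pole g z \<longleftrightarrow> zorder g z < 0"
  using isolated_pole_imp_neg_zorder[OF sing_at(1)]
    neg_zorder_imp_is_pole[OF sing_at _ nz_at_frequently] by blast

lemma bad_sparse: "bad sparse_in UNIV"
proof -
  have "\<forall>\<^sub>\<approx>z. z \<notin> bad"
    using meromorphic_on_imp_analytic_cosparse[OF mero] nz_cosparse
    by eventually_elim (auto simp: bad_def)
  thus ?thesis by (simp add: eventually_cosparse)
qed

lemma eventually_not_bad: "eventually (\<lambda>z. z \<notin> bad) (at w)"
  using bad_sparse by (intro eventually_cosparse_imp_eventually_at[where A = UNIV]) (auto simp: eventually_cosparse)

lemma finite_bad: "finite (cball 0 r \<inter> bad)"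
  using sparse_in_compact_finite[OF sparse_in_subset[OF bad_sparse subset_UNIV] compact_cball] .

lemma div_pts_subset_bad: "div_pts r \<subseteq> cball 0 r \<inter> bad"
  using zorder_eq_0_if_not_bad by (auto simp: div_pts_def)

lemma finite_div_pts: "finite (div_pts r)"
  using finite_subset[OF div_pts_subset_bad finite_bad] .

text \<open>A bounded disc contains only finitely many bad points, whereas the interval contains
  infinitely many radii.\<close>

lemma good_radius_exists:
  assumes "0 < x" "x < y"
  obtains r where "x \<le> r" "r \<le> y" "good r"
proof -
  have "finite (norm ` (cball 0 y \<inter> bad))" using finite_bad by blast
  moreover have "infinite {x..y}" using assms by simp
  ultimately have "\<not> {x..y} \<subseteq> norm ` (cball 0 y \<inter> bad)" using finite_subset by blast
  then obtain r where "r \<in> {x..y}" "r \<notin> norm ` (cball 0 y \<inter> bad)" by blast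
  thus ?thesis using assms by (intro that[of r]) (auto simp: good_def)
qed

text \<open>Dividing \<open>g\<close> by the product over its divisor leaves order zero everywhere
  on a slightly larger disc. After removing singularities the quotient is holomorphic and zero-free
  on that disc, hence an exponential.\<close>

lemma factorization:
  assumes "good R"
  obtains h A where "open A" "cball 0 R \<subseteq> A" "h holomorphic_on A"
    "\<And>z. z \<in> A \<Longrightarrow> z \<notin> bad \<Longrightarrow> g z = (\<Prod>s\<in>div_pts R. (z - s) powi zorder g s) * exp (h z)"
proof -
  have R: "R > 0" using assms by (simp add: good_def)
  have "finite (norm ` div_pts (R + 1))" using finite_div_pts by blast
  then obtain d where d: "d > 0" "\<And>x. x \<in> norm ` div_pts (R + 1) \<Longrightarrow> x \<noteq> R \<Longrightarrow> d \<le> dist R x"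
    using finite_set_avoid[of "norm ` div_pts (R + 1)" R] by blast
  \<comment> \<open>The gap \<open>d\<close> separates \<open>R\<close> from all other moduli of
    divisor points. The minimum with 1 keeps the larger disc inside radius \<open>R + 1\<close>,
    where these moduli were listed.\<close>
  define R' where "R' = R + min d 1"
  have R': "R < R'" using d(1) by (simp add: R'_def)
  have div: "norm s \<le> R" if "norm s < R'" "zorder g s \<noteq> 0" for s
  proof (rule ccontr)
    assume "\<not> norm s \<le> R"
    moreover have "s \<in> div_pts (R + 1)" using that by (auto simp: div_pts_def R'_def)
    ultimately have "d \<le> norm s - R" using d(2)[of "norm s"] by (auto simp: dist_real_def)
    thus False using that(1) by (simp add: R'_def)
  qed
  define D where "D = div_pts R"
  have fin: "finite D" using finite_div_pts by (simp add: D_def)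
  define P where "P = (\<lambda>z. \<Prod>s\<in>D. (z - s) powi zorder g s)"
  define f where "f = (\<lambda>z. g z / P z)"
  define u where "u = remove_sings f"
  have P_mero: "P meromorphic_on X" for X
    unfolding P_def by (intro meromorphic_intros)
  have P_ana: "P analytic_on {z}" if "z \<notin> D" for z
    unfolding P_def using that by (intro analytic_intros) auto
  have P_nz: "P z \<noteq> 0" if "z \<notin> D" for z
    using that fin by (auto simp: P_def power_int_eq_0_iff)
  have ev_D: "eventually (\<lambda>w. w \<notin> D) (at z)" for z
    using islimpt_finite[OF fin, of z] by (simp add: islimpt_conv_frequently_at frequently_def)
  have P_nz_at: "eventually (\<lambda>w. P w \<noteq> 0) (at z)" for z
    using ev_D by eventually_elim (use P_nz in auto)
  have f_mero: "f meromorphic_on {z}" for z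
    unfolding f_def by (intro meromorphic_intros mero_at P_mero)
  have f_nz: "eventually (\<lambda>w. f w \<noteq> 0) (at z)" for z
    using P_nz_at nz_at by eventually_elim (auto simp: f_def)
  have zP: "zorder P z = (if z \<in> D then zorder g z else 0)" for z
  proof -
    have lin_nz: "frequently (\<lambda>w. w - s \<noteq> 0) (at z)" for s :: complex
    proof -
      have "eventually (\<lambda>w. w \<noteq> s) (at z)"
        by (rule eventually_neq_at_within)
      hence "eventually (\<lambda>w. w - s \<noteq> 0) (at z)" by eventually_elim auto
      thus ?thesis by (intro eventually_frequently) auto
    qed
    have "zorder P z = (\<Sum>s\<in>D. zorder (\<lambda>w. (w - s) powi zorder g s) z)"
      unfolding P_def using P_nz_at[of z] unfolding P_def
      by (intro zorder_prod meromorphic_intros) auto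
    also have "\<dots> = (\<Sum>s\<in>D. if z = s then zorder g s else 0)"
      by (intro sum.cong refl, subst zorder_power_int)
         (use lin_nz in \<open>auto intro!: meromorphic_intros simp: zorder_linear\<close>)
    also have "\<dots> = (if z \<in> D then zorder g z else 0)"
      using fin by simp
    finally show ?thesis .
  qed
  have zf: "zorder f z = 0" if "norm z < R'" for z
  proof -
    have "zorder f z = zorder g z - zorder P z"
      unfolding f_def using P_nz_at[of z]
      by (intro zorder_divide mero_at P_mero nz_at_frequently eventually_frequently) auto
    thus ?thesis using div[OF that] by (auto simp: zP D_def div_pts_def)
  qed
  have "u holomorphic_on ball 0 R'"
    using remove_sings_zorder_0(1)[OF f_mero f_nz zf] unfolding u_def
    by (intro analytic_imp_holomorphic) (subst analytic_on_analytic_at, auto)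
  moreover have "u z \<noteq> 0" if "z \<in> ball 0 R'" for z
    using remove_sings_zorder_0(2)[OF f_mero f_nz zf, of z] that by (auto simp: u_def)
  ultimately obtain h where h: "h holomorphic_on ball 0 R'" "\<And>z. z \<in> ball 0 R' \<Longrightarrow> exp (h z) = u z"
    using R R' by (elim holomorphic_logarithm_exists[rotated 2, of u _ 0]) auto
  show ?thesis
  proof (rule that[of "ball 0 R'" h])
    fix z assume z: "z \<in> ball 0 R'" "z \<notin> bad"
    have zD: "z \<notin> D" using z(2) div_pts_subset_bad by (auto simp: D_def)
    have "g analytic_on {z}" using z(2) by (auto simp: bad_def)
    hence "f analytic_on {z}" unfolding f_def
      using P_ana[OF zD] P_nz[OF zD] by (intro analytic_intros) auto
    \<comment> \<open>Where \<open>f\<close> is already analytic, removing singularities does not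
      alter its value.\<close>
    hence "u z = f z" by (simp add: u_def)
    thus "g z = (\<Prod>s\<in>div_pts R. (z - s) powi zorder g s) * exp (h z)"
      using P_nz[OF zD] h(2)[OF z(1)] by (simp add: f_def P_def D_def)
  qed (use h R' in auto)
qed

text \<open>Cancelling the power of \<open>w\<close> from both the Laurent form of \<open>g\<close>
  at 0 and the factorization leaves two continuous functions that agree near 0; their values at 0
  are compared.\<close>

lemma Re_log_factor_at_0:
  assumes "good R" "open A" "cball 0 R \<subseteq> A" "h holomorphic_on A"
    and fac: "\<And>z. z \<in> A \<Longrightarrow> z \<notin> bad \<Longrightarrow> g z = (\<Prod>s\<in>div_pts R. (z - s) powi zorder g s) * exp (h z)"
  shows "Re (h 0) = ln_lead - (\<Sum>s\<in>div_pts R. of_int (zorder g s) * ln (norm s))"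
proof -
  have R: "R > 0" using assms(1) by (simp add: good_def)
  define Q where "Q = (\<lambda>w. \<Prod>s\<in>div_pts R - {0}. (w - s) powi zorder g s)"
  define p where "p = zor_poly g 0"
  obtain r where p0: "p 0 \<noteq> 0" and r: "r > 0" "p holomorphic_on cball 0 r"
      "\<And>w. w \<in> cball 0 r - {0} \<Longrightarrow> g w = p w * w powi zorder g 0"
    using zorder_exist[OF sing_at nz_at_frequently, of 0] unfolding p_def by auto
  have eq: "(\<Prod>s\<in>div_pts R. (w - s) powi zorder g s) = w powi zorder g 0 * Q w" if "w \<noteq> 0" for w
  proof (cases "0 \<in> div_pts R")
    case True
    thus ?thesis unfolding Q_def using finite_div_pts by (subst prod.remove[of _ 0]) auto
  next
    case False
    hence "zorder g 0 = 0" using R by (simp add: div_pts_def)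
    thus ?thesis using False by (simp add: Q_def)
  qed
  have cQ: "isCont Q 0" unfolding Q_def
    by (intro continuous_intros) auto
  have "0 \<in> A" using assms(3) R by auto
  hence ch: "isCont h 0" using assms(2,4)
    by (meson holomorphic_on_imp_continuous_on continuous_on_eq_continuous_at)
  have cp: "isCont p 0"
    using holomorphic_on_imp_continuous_on[OF r(2)] r(1) continuous_on_interior[of "cball 0 r" p 0] by auto
  have "eventually (\<lambda>w. p w = Q w * exp (h w)) (at 0)"
  proof -
    have "eventually (\<lambda>w. w \<in> A) (at 0)"
      using assms(2) \<open>0 \<in> A\<close> by (rule eventually_at_in_open')
    moreover have "eventually (\<lambda>w. w \<in> ball 0 r - {0}) (at 0)"
      using r(1) by (intro eventually_at_in_open) auto
    ultimately show ?thesis using eventually_not_bad[of 0]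
    proof eventually_elim
      case (elim w)
      hence "p w * w powi zorder g 0 = (w powi zorder g 0 * Q w) * exp (h w)"
        using fac[of w] r(3)[of w] eq[of w] by auto
      thus ?case using elim by (auto simp: power_int_eq_0_iff)
    qed
  qed
  moreover have "(p \<longlongrightarrow> p 0) (at 0)" using cp by (simp add: isCont_def)
  ultimately have "((\<lambda>w. Q w * exp (h w)) \<longlongrightarrow> p 0) (at 0)"
    by (rule iffD1[OF tendsto_cong])
  moreover have "((\<lambda>w. Q w * exp (h w)) \<longlongrightarrow> Q 0 * exp (h 0)) (at 0)"
    using cQ ch by (intro tendsto_intros) (auto simp: isCont_def)
  ultimately have "p 0 = Q 0 * exp (h 0)" by (intro LIM_unique)
  moreover from this p0 have Q0: "Q 0 \<noteq> 0" by auto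
  ultimately have "ln_lead = ln (norm (Q 0)) + Re (h 0)"
    unfolding ln_lead_def p_def[symmetric] by (simp add: norm_mult ln_mult)
  also have "ln (norm (Q 0)) = (\<Sum>s\<in>div_pts R - {0}. of_int (zorder g s) * ln (norm s))"
    unfolding Q_def prod_norm[symmetric] using finite_div_pts
    by (subst ln_prod) (auto simp: norm_power_int power_int_eq_0_iff ln_power_int)
  \<comment> \<open>The origin may be put back into the index set because
    \<open>ln 0 = 0\<close>.\<close>
  also have "\<dots> = (\<Sum>s\<in>div_pts R. of_int (zorder g s) * ln (norm s))"
    using finite_div_pts by (intro sum.mono_neutral_left) auto
  finally show ?thesis by simp
qed

lemma good_div_pts_less:
  assumes "good R" "s \<in> div_pts R"
  shows "norm s < R"
  using assms div_pts_subset_bad[of R] by (force simp: good_def)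

lemma good_circle:
  assumes "good R"
  shows "norm (R * cis t) = R" "R * cis t \<notin> bad"
  using assms by (auto simp: good_def norm_mult)

lemma ln_norm_factorization:
  assumes "good R" "norm z = R"
    and fac: "g z = (\<Prod>s\<in>div_pts R. (z - s) powi zorder g s) * exp (h z)"
  shows "ln (norm (g z)) = (\<Sum>s\<in>div_pts R. of_int (zorder g s) * ln (norm (z - s))) + Re (h z)"
proof -
  have zs: "z - s \<noteq> 0" if "s \<in> div_pts R" for s
    using good_div_pts_less[OF assms(1) that] assms(2) by auto
  have "ln (norm (g z)) = ln (\<Prod>s\<in>div_pts R. norm (z - s) powi zorder g s) + Re (h z)"
    using fac zs finite_div_pts
    by (simp add: norm_mult ln_mult norm_power_int power_int_eq_0_iff flip: prod_norm)
  also have "ln (\<Prod>s\<in>div_pts R. norm (z - s) powi zorder g s) =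
      (\<Sum>s\<in>div_pts R. of_int (zorder g s) * ln (norm (z - s)))"
    using zs finite_div_pts by (subst ln_prod) (auto simp: power_int_eq_0_iff ln_power_int)
  finally show ?thesis .
qed

text \<open>Integrate the logarithm of the factorization: each linear factor has mean
  \<open>ln R\<close>, and the harmonic part \<open>Re h\<close> has mean
  \<open>Re (h 0)\<close>.\<close>

lemma has_integral_ln_norm_circle:
  assumes "good R"
  shows "((\<lambda>t. ln (norm (g (R * cis t)))) has_integral
    2 * pi * (ln_lead + (\<Sum>s\<in>div_pts R. of_int (zorder g s) * (ln R - ln (norm s))))) {0..2 * pi}"
proof -
  have R: "R > 0" using assms by (simp add: good_def)
  obtain h A where hA: "open A" "cball 0 R \<subseteq> A" "h holomorphic_on A"
    "\<And>z. z \<in> A \<Longrightarrow> z \<notin> bad \<Longrightarrow> g z = (\<Prod>s\<in>div_pts R. (z - s) powi zorder g s) * exp (h z)"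
    using factorization[OF assms] by metis
  have "((\<lambda>t. (\<Sum>s\<in>div_pts R. of_int (zorder g s) * ln (norm (R * cis t - s))) + Re (h (R * cis t)))
     has_integral (\<Sum>s\<in>div_pts R. of_int (zorder g s) * (2 * pi * ln R)) + Re (2 * pi * h 0)) {0..2 * pi}"
    by (intro has_integral_add has_integral_sum has_integral_mult_right circle_mean_ln_norm
        finite_div_pts has_integral_Re circle_mean_value[OF hA(3,1,2) R] good_div_pts_less[OF assms])
  also have "(\<Sum>s\<in>div_pts R. of_int (zorder g s) * (2 * pi * ln R)) + Re (2 * pi * h 0) =
     2 * pi * (ln_lead + (\<Sum>s\<in>div_pts R. of_int (zorder g s) * (ln R - ln (norm s))))"
    by (simp add: Re_log_factor_at_0[OF assms hA] algebra_simps sum_subtractf sum_distrib_left)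
  also have "(\<lambda>t. (\<Sum>s\<in>div_pts R. of_int (zorder g s) * ln (norm (R * cis t - s))) + Re (h (R * cis t))) =
    (\<lambda>t. ln (norm (g (R * cis t))))"
  proof
    fix t
    define z where "z = R * cis t"
    have z: "norm z = R" "z \<notin> bad" using good_circle[OF assms] by (auto simp: z_def)
    hence "z \<in> A" using hA(2) by auto
    show "(\<Sum>s\<in>div_pts R. of_int (zorder g s) * ln (norm (R * cis t - s))) + Re (h (R * cis t)) =
       ln (norm (g (R * cis t)))"
      using ln_norm_factorization[where h = h, OF assms z(1) hA(4)[OF \<open>z \<in> A\<close> z(2)]] by (simp add: z_def)
  qed
  finally show ?thesis .
qed

lemma continuous_on_good_circle:
  assumes "good R"
  shows "continuous_on X (\<lambda>t. g (R * cis t))"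
proof (rule continuous_on_compose2[where g = g and f = "\<lambda>t. R * cis t", OF _ _ subset_refl])
  show "continuous_on X (\<lambda>t. R * cis t)" by (intro continuous_intros)
  have "isCont g (R * cis t)" for t
    using good_circle[OF assms, of t] by (auto simp: bad_def intro: analytic_at_imp_isCont)
  thus "continuous_on ((\<lambda>t. R * cis t) ` X) g"
    by (intro continuous_at_imp_continuous_on) auto
qed

lemma has_integral_proximity:
  assumes "good R"
  shows "((\<lambda>t. log_plus (norm (g (R * cis t)))) has_integral 2 * pi * proximity g R) {0..2 * pi}"
proof -
  have "continuous_on {0..2 * pi} (\<lambda>t. log_plus (norm (g (R * cis t))))"
    unfolding log_plus_def by (intro continuous_intros continuous_on_good_circle assms) auto
  hence "(\<lambda>t. log_plus (norm (g (R * cis t)))) integrable_on {0..2 * pi}"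
    by (rule integrable_continuous_real)
  thus ?thesis by (simp add: proximity_def integrable_integral)
qed

section \<open>Counting functions and the characteristic\<close>

lemma pole_count_eq:
  assumes "t \<le> R"
  shows "real (pole_count g t) = (\<Sum>s\<in>div_pts R. if norm s \<le> t then real (nat (- zorder g s)) else 0)"
proof -
  have "pole_count g t = (\<Sum>s\<in>{s \<in> div_pts R. norm s \<le> t}. nat (- zorder g s))"
    unfolding pole_count_def
  proof (rule sum.mono_neutral_left)
    show "finite {s \<in> div_pts R. norm s \<le> t}" using finite_div_pts by simp
  qed (use assms in \<open>auto simp: is_pole_iff_zorder div_pts_def\<close>)
  also have "real \<dots> = (\<Sum>s\<in>div_pts R. if norm s \<le> t then real (nat (- zorder g s)) else 0)"
    using finite_div_pts by (simp add: sum.inter_filter if_distrib cong: if_cong)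
  finally show ?thesis .
qed

text \<open>A pole \<open>s \<noteq> 0\<close> contributes its multiplicity times the integral of
  \<open>1 / t\<close> from \<open>|s|\<close> to \<open>R\<close>.\<close>

lemma integrated_pole_count_eq:
  assumes "R > 0"
  shows "integrated_pole_count g R = (\<Sum>s\<in>div_pts R. real (nat (- zorder g s)) * (ln R - ln (norm s)))"
proof -
  define m where "m = (\<lambda>s. real (nat (- zorder g s)))"
  have seg: "((\<lambda>t. (if norm s \<le> t then m s else 0) / t) has_integral m s * (ln R - ln (norm s))) {0..R}"
    if "s \<in> div_pts R - {0}" for s
  proof -
    have s: "0 < norm s" "norm s \<le> R" using that by (auto simp: div_pts_def)
    have "((\<lambda>t. m s * (1 / t)) has_integral m s * (ln R - ln (norm s))) {norm s..R}"
      using s by (intro has_integral_mult_right fundamental_theorem_of_calculus)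
        (auto intro!: derivative_eq_intros less_le_trans[OF s(1)] simp flip: has_real_derivative_iff_has_vector_derivative)
    hence "((\<lambda>t. if t \<in> {norm s..R} then m s * (1 / t) else 0) has_integral
        m s * (ln R - ln (norm s))) {0..R}"
      using s by (subst has_integral_restrict) auto
    thus ?thesis by (rule has_integral_eq[rotated]) auto
  qed
  have "((\<lambda>t. \<Sum>s\<in>div_pts R - {0}. (if norm s \<le> t then m s else 0) / t) has_integral
      (\<Sum>s\<in>div_pts R - {0}. m s * (ln R - ln (norm s)))) {0..R}"
    using finite_div_pts by (intro has_integral_sum seg) auto
  moreover have "(\<Sum>s\<in>div_pts R - {0}. (if norm s \<le> t then m s else 0) / t) =
      (real (pole_count g t) - real (pole_count g 0)) / t" if "t \<in> {0..R}" for t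
  proof -
    have "real (pole_count g t) - real (pole_count g 0) =
        (\<Sum>s\<in>div_pts R. if norm s \<le> t \<and> s \<noteq> 0 then m s else 0)"
      using that assms unfolding pole_count_eq[of t R, simplified] m_def
      by (subst pole_count_eq[of t R], simp, subst pole_count_eq[of 0 R])
         (auto simp flip: sum_subtractf intro!: sum.cong)
    also have "\<dots> = (\<Sum>s\<in>div_pts R - {0}. if norm s \<le> t then m s else 0)"
      using finite_div_pts by (intro sum.mono_neutral_cong_right) auto
    finally show ?thesis by (simp add: sum_divide_distrib)
  qed
  ultimately have "((\<lambda>t. (real (pole_count g t) - real (pole_count g 0)) / t) has_integral
      (\<Sum>s\<in>div_pts R - {0}. m s * (ln R - ln (norm s)))) {0..R}"
    by (rule has_integral_eq[rotated])
  hence "integrated_pole_count g R =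
      (\<Sum>s\<in>div_pts R - {0}. m s * (ln R - ln (norm s))) + real (pole_count g 0) * ln R"
    unfolding integrated_pole_count_def by (simp add: integral_unique)
  \<comment> \<open>A pole at the origin fits the same formula, since \<open>ln 0 = 0\<close> gives
    it the weight \<open>ln R\<close>.\<close>
  also have "real (pole_count g 0) * ln R = (\<Sum>s\<in>div_pts R \<inter> {0}. m s * (ln R - ln (norm s)))"
  proof -
    have "real (pole_count g 0) = (\<Sum>s\<in>div_pts R \<inter> {0}. m s)"
      using finite_div_pts assms unfolding m_def
      by (subst pole_count_eq[of 0 R]) (auto intro!: sum.mono_neutral_cong_right)
    thus ?thesis by (simp add: sum_distrib_right)
  qed
  also have "(\<Sum>s\<in>div_pts R - {0}. m s * (ln R - ln (norm s))) +
      (\<Sum>s\<in>div_pts R \<inter> {0}. m s * (ln R - ln (norm s))) =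
      (\<Sum>s\<in>div_pts R. m s * (ln R - ln (norm s)))"
    using sum.Int_Diff[OF finite_div_pts, of "\<lambda>s. m s * (ln R - ln (norm s))" R "{0}"] by simp
  finally show ?thesis by (simp add: m_def)
qed

lemma div_weight_nonneg:
  assumes "R \<ge> 1" "s \<in> div_pts R"
  shows "0 \<le> ln R - ln (norm s)"
  using assms by (cases "s = 0") (auto simp: div_pts_def)

text \<open>The convention \<^prop>\<open>ln 0 = (0 :: real)\<close> gives a zero or pole at the origin the weight
  \<^term>\<open>ln R\<close>, as in the integrated counting function.\<close>

definition div_weight :: "real \<Rightarrow> real" where
  "div_weight R = (\<Sum>s\<in>div_pts R. of_int \<bar>zorder g s\<bar> * (ln R - ln (norm s)))"

lemma div_weight_sum_nonneg: "R \<ge> 1 \<Longrightarrow> 0 \<le> div_weight R"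
  unfolding div_weight_def by (intro sum_nonneg mult_nonneg_nonneg div_weight_nonneg) auto

lemma Jensen:
  assumes "good R"
  shows "((\<lambda>t. ln (norm (g (R * cis t)))) has_integral
    2 * pi * (ln_lead + div_weight R - 2 * integrated_pole_count g R)) {0..2 * pi}"
proof -
  have R: "R > 0" using assms by (simp add: good_def)
  \<comment> \<open>This is \<open>n = |n| - 2 * max (- n) 0\<close>: the signed sum is the unsigned
    one minus twice the pole part.\<close>
  have *: "of_int (zorder g s) * w = of_int \<bar>zorder g s\<bar> * w - 2 * (real (nat (- zorder g s)) * w)" for s w
    by (cases "zorder g s \<ge> 0") (auto simp: algebra_simps)
  have "(\<Sum>s\<in>div_pts R. of_int (zorder g s) * (ln R - ln (norm s))) =
      div_weight R - 2 * integrated_pole_count g R"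
    unfolding div_weight_def integrated_pole_count_eq[OF R] sum_distrib_left sum_subtractf[symmetric]
    by (intro sum.cong refl *)
  with has_integral_ln_norm_circle[OF assms] show ?thesis by (simp only: add_diff_eq)
qed

lemma circle_nonzero: "good R \<Longrightarrow> g (R * cis t) \<noteq> 0"
  using good_circle(2)[of R t] by (auto simp: bad_def)

text \<open>Jensen's formula together with \<open>ln \<le> log_plus\<close> bounds the integrated
  counts of zeros and poles, as in the first fundamental theorem.\<close>

lemma div_weight_le:
  assumes "good R" "R \<ge> 1"
  shows "div_weight R \<le> 2 * nevanlinna_char g R - ln_lead"
proof -
  have "2 * pi * (ln_lead + div_weight R - 2 * integrated_pole_count g R) \<le> 2 * pi * proximity g R"
    using circle_nonzero[OF assms(1)]
    by (intro has_integral_le[OF Jensen[OF assms(1)] has_integral_proximity[OF assms(1)]] ln_le_log_plus) auto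
  hence "ln_lead + div_weight R - 2 * integrated_pole_count g R \<le> proximity g R"
    by (subst (asm) mult_le_cancel_left_pos) auto
  thus ?thesis using proximity_nonneg[of g R] by (simp add: nevanlinna_char_def)
qed

lemma div_count_nonneg: "0 \<le> div_count r"
  unfolding div_count_def by (intro sum_nonneg) auto

lemma div_count_mono: "r \<le> r' \<Longrightarrow> div_count r \<le> div_count r'"
  unfolding div_count_def using finite_div_pts by (intro sum_mono2) (auto simp: div_pts_def)

text \<open>A point with \<open>0 < |s| \<le> r\<close> has weight
  \<open>ln R - ln |s| \<ge> ln (r ^ 2) - ln r = ln r\<close> in \<open>div_weight R\<close>. This
  gains the factor \<open>ln r\<close>.\<close>

lemma div_count_le:
  assumes "good R" "1 \<le> r" "r ^ 2 \<le> R"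
  shows "div_count r * ln r \<le> 2 * nevanlinna_char g R - ln_lead"
proof -
  have "r \<le> r ^ 2" using assms(2) by (simp add: power2_eq_square)
  hence R: "R \<ge> 1" "r \<le> R" using assms by linarith+
  have "ln (r ^ 2) \<le> ln R" using assms by (subst ln_le_cancel_iff) (auto intro: order_less_le_trans[of 0 "r^2"])
  hence lnR: "2 * ln r \<le> ln R" using assms by (simp add: ln_realpow)
  have ln0: "0 \<le> ln r" using assms by simp
  have w: "ln r \<le> ln R - ln (norm s)" if "s \<in> div_pts r" for s
  proof (cases "s = 0")
    case False
    hence "ln (norm s) \<le> ln r" using that assms(2) by (subst ln_le_cancel_iff) (auto simp: div_pts_def)
    thus ?thesis using lnR by linarith
  qed (use lnR ln0 in auto)
  have "div_count r * ln r \<le> (\<Sum>s\<in>div_pts r. of_int \<bar>zorder g s\<bar> * (ln R - ln (norm s)))"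
    unfolding div_count_def sum_distrib_right by (intro sum_mono mult_left_mono w) auto
  also have "\<dots> \<le> div_weight R" unfolding div_weight_def
  proof (rule sum_mono2[OF finite_div_pts])
    show "div_pts r \<subseteq> div_pts R" using R by (auto simp: div_pts_def)
    fix s assume "s \<in> div_pts R - div_pts r"
    thus "0 \<le> of_int \<bar>zorder g s\<bar> * (ln R - ln (norm s))"
      using div_weight_nonneg[OF R(1), of s] by (intro mult_nonneg_nonneg) auto
  qed
  also have "\<dots> \<le> 2 * nevanlinna_char g R - ln_lead"
    by (rule div_weight_le[OF assms(1) R(1)])
  finally show ?thesis .
qed

text \<open>The Schwarz bound needs the integral of \<open>|Re h|\<close>. The factorization
  majorises \<open>|Re h|\<close> by absolute logarithms of \<open>g\<close> and of the linear
  factors.\<close>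

lemma log_factor_bound:
  assumes "good R" "R \<ge> 1" "open A" "cball 0 R \<subseteq> A" "h holomorphic_on A"
    and fac: "\<And>z. z \<in> A \<Longrightarrow> z \<notin> bad \<Longrightarrow> g z = (\<Prod>s\<in>div_pts R. (z - s) powi zorder g s) * exp (h z)"
    and z: "norm z \<le> R / 2"
  shows "norm (h z - h 0) \<le> 4 * norm z / R * (2 * nevanlinna_char g R - ln_lead + 2 * div_count R * ln (1 + 2 * R))"
proof -
  have R: "R > 0" using assms(2) by simp
  define L where "L = ln (1 + 2 * R)"
  \<comment> \<open>Both parts use \<open>|ln x| = 2 * log_plus x - ln x\<close>, because the
    integral of the \<open>ln\<close> term is known exactly. For the linear factors
    \<open>log_plus\<close> is bounded by \<open>L\<close>, as
    \<open>|R * cis t - s| \<le> 2 * R\<close>.\<close>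
  define F where "F = (\<lambda>t. 2 * log_plus (norm (g (R * cis t))) - ln (norm (g (R * cis t))) +
     (\<Sum>s\<in>div_pts R. of_int \<bar>zorder g s\<bar> * (2 * L - ln (norm (R * cis t - s)))))"
  define I where "I = 2 * (2 * pi * proximity g R) -
       2 * pi * (ln_lead + div_weight R - 2 * integrated_pole_count g R) +
     (\<Sum>s\<in>div_pts R. of_int \<bar>zorder g s\<bar> * (2 * L * (2 * pi) - 2 * pi * ln R))"
  have F: "(F has_integral I) {0..2 * pi}"
    unfolding F_def I_def using has_integral_const_real[of "2 * L" 0 "2 * pi"]
    by (intro has_integral_add has_integral_diff has_integral_sum has_integral_mult_right circle_mean_ln_norm
        finite_div_pts Jensen has_integral_proximity good_div_pts_less[OF assms(1)] assms(1))
       (auto simp: mult.commute)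
  have "continuous_on {0..2 * pi} (\<lambda>t. \<bar>Re (h (R * cis t))\<bar>)"
  proof -
    have "continuous_on A h" using assms(5) by (rule holomorphic_on_imp_continuous_on)
    moreover have "continuous_on {0..2 * pi} (\<lambda>t. R * cis t)"
      by (intro continuous_intros)
    moreover have "R * cis t \<in> A" for t
      using subsetD[OF assms(4), of "R * cis t"] good_circle(1)[OF assms(1), of t] by simp
    hence "(\<lambda>t. R * cis t) ` {0..2 * pi} \<subseteq> A" by blast
    ultimately have "continuous_on {0..2 * pi} (\<lambda>t. h (R * cis t))"
      by (rule continuous_on_compose2)
    thus ?thesis by (intro continuous_intros)
  qed
  hence J: "((\<lambda>t. \<bar>Re (h (R * cis t))\<bar>) has_integral integral {0..2 * pi} (\<lambda>t. \<bar>Re (h (R * cis t))\<bar>)) {0..2 * pi}"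
    (is "(_ has_integral ?J) _")
    by (intro integrable_integral integrable_continuous_real)
  have le: "\<bar>Re (h (R * cis t))\<bar> \<le> F t" for t
  proof -
    define w where "w = R * cis t"
    have w: "norm w = R" "w \<notin> bad" using good_circle[OF assms(1)] by (auto simp: w_def)
    hence "w \<in> A" using assms(4) by auto
    have ws: "w - s \<noteq> 0" if "s \<in> div_pts R" for s
      using good_div_pts_less[OF assms(1) that] w by auto
    have "ln (norm (g w)) = (\<Sum>s\<in>div_pts R. of_int (zorder g s) * ln (norm (w - s))) + Re (h w)"
      by (rule ln_norm_factorization[where h = h, OF assms(1) w(1) fac[OF \<open>w \<in> A\<close> w(2)]])
    hence "\<bar>Re (h w)\<bar> \<le> \<bar>ln (norm (g w))\<bar> + \<bar>\<Sum>s\<in>div_pts R. of_int (zorder g s) * ln (norm (w - s))\<bar>"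
      by linarith
    also have "\<bar>\<Sum>s\<in>div_pts R. of_int (zorder g s) * ln (norm (w - s))\<bar> \<le>
       (\<Sum>s\<in>div_pts R. \<bar>of_int (zorder g s) * ln (norm (w - s))\<bar>)" by (rule sum_abs)
    also have "\<dots> \<le> (\<Sum>s\<in>div_pts R. of_int \<bar>zorder g s\<bar> * (2 * L - ln (norm (w - s))))"
    proof (rule sum_mono)
      fix s assume s: "s \<in> div_pts R"
      have "norm (w - s) \<le> 2 * R"
        using norm_triangle_ineq4[of w s] w good_div_pts_less[OF assms(1) s] by simp
      hence "log_plus (norm (w - s)) \<le> L" unfolding L_def using R by (intro log_plus_le_ln) auto
      hence "\<bar>ln (norm (w - s))\<bar> \<le> 2 * L - ln (norm (w - s))"
        using abs_ln_eq[of "norm (w - s)"] ws[OF s] by simp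
      thus "\<bar>of_int (zorder g s) * ln (norm (w - s))\<bar> \<le> of_int \<bar>zorder g s\<bar> * (2 * L - ln (norm (w - s)))"
        unfolding abs_mult by (simp add: mult_left_mono)
    qed
    also have "\<bar>ln (norm (g w))\<bar> = 2 * log_plus (norm (g w)) - ln (norm (g w))"
      using circle_nonzero[OF assms(1), of t] by (intro abs_ln_eq) (simp add: w_def)
    finally show ?thesis by (simp add: F_def w_def)
  qed
  have JI: "?J \<le> I" by (rule has_integral_le[OF J F]) (rule le)
  have "I \<le> 2 * pi * (2 * nevanlinna_char g R - ln_lead + 2 * div_count R * L)"
  proof -
    have "(\<Sum>s\<in>div_pts R. of_int \<bar>zorder g s\<bar> * (2 * L * (2 * pi) - 2 * pi * ln R)) =
        2 * pi * (div_count R * (2 * L - ln R))"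
      unfolding div_count_def sum_distrib_right sum_distrib_left
      by (intro sum.cong) (auto simp: algebra_simps)
    hence "I = 2 * pi * (2 * proximity g R - ln_lead - div_weight R + 2 * integrated_pole_count g R +
        div_count R * (2 * L - ln R))"
      unfolding I_def by (simp add: algebra_simps)
    \<comment> \<open>The terms with \<open>ln R\<close> and \<open>div_weight R\<close> have a
      favourable sign and are dropped.\<close>
    moreover have "div_count R * (2 * L - ln R) \<le> div_count R * (2 * L)"
      using assms(2) by (intro mult_left_mono div_count_nonneg) auto
    hence "2 * proximity g R - ln_lead - div_weight R + 2 * integrated_pole_count g R +
        div_count R * (2 * L - ln R) \<le> 2 * nevanlinna_char g R - ln_lead + 2 * div_count R * L"
      using div_weight_sum_nonneg[OF assms(2)] by (simp add: nevanlinna_char_def)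
    ultimately show ?thesis by (simp add: mult_left_mono)
  qed
  hence JB: "?J \<le> 2 * pi * (2 * nevanlinna_char g R - ln_lead + 2 * div_count R * L)" (is "_ \<le> 2 * pi * ?B")
    using JI by linarith
  have J0: "0 \<le> ?J" by (rule has_integral_nonneg[OF J]) auto
  have zR: "norm z < R" "R / 2 \<le> R - norm z" using z R by auto
  have "norm (h z - h 0) \<le> norm z / (pi * (R - norm z)) * ?J"
    by (rule Schwarz_integral_bound[OF assms(5,3,4) zR(1) J])
  also have "\<dots> \<le> norm z / (pi * (R / 2)) * (2 * pi * ?B)"
    using JB J0 zR R by (intro mult_mono divide_left_mono) auto
  also have "\<dots> = 4 * norm z / R * ?B" using R by (simp add: field_simps)
  finally show ?thesis by (simp add: L_def)
qed

end

subsection \<open>Growth estimates\<close>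

lemma finite_circle_vimage:
  fixes r :: real
  assumes "r \<noteq> 0" "finite X"
  shows "finite {t \<in> {0..2 * pi}. r * cis t \<in> X}"
proof -
  have "inj_on (\<lambda>t. r * cis t) {0..<2 * pi}"
  proof (rule inj_onI)
    fix t u assume *: "t \<in> {0..<2 * pi}" "u \<in> {0..<2 * pi}" "r * cis t = r * cis u"
    show "t = u"
    proof (rule ccontr)
      assume "t \<noteq> u"
      hence "0 < norm (cis t - cis u)" using *(1,2) by (intro inverse_sqrt_norm_cis_diff_le) auto
      thus False using *(3) assms(1) by simp
    qed
  qed
  hence "finite ((\<lambda>t. r * cis t) -` X \<inter> {0..<2 * pi})" by (rule finite_vimage_IntI[OF assms(2)])
  moreover have "{t \<in> {0..2 * pi}. r * cis t \<in> X} \<subseteq>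
      insert (2 * pi) ((\<lambda>t. r * cis t) -` X \<inter> {0..<2 * pi})" by auto
  ultimately show ?thesis by (meson finite_insert finite_subset)
qed

lemma eventually_ln_ge: "eventually (\<lambda>r::real. c \<le> ln r) at_top"
  using ln_at_top by (simp add: filterlim_at_top)

lemma ln_powr_div_tendsto_0:
  fixes p :: real
  assumes "p > 0"
  shows "((\<lambda>r. ln r powr p / r) \<longlongrightarrow> 0) at_top"
proof -
  \<comment> \<open>This exponent makes \<open>(r powr a) powr p\<close> equal to
    \<open>r powr (1 / 2)\<close>.\<close>
  define a where "a = 1 / (2 * p)"
  have a: "a > 0" using assms by (simp add: a_def)
  have up: "eventually (\<lambda>r. ln r powr p / r \<le> r powr (- 1 / 2) / a powr p) at_top"
    using eventually_ge_at_top[of 1]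
  proof eventually_elim
    case (elim r)
    have "ln r powr p \<le> (r powr a / a) powr p"
      using elim assms a by (intro powr_mono2 ln_powr_bound) auto
    also have "\<dots> = r powr (a * p) / a powr p"
      using a by (simp add: powr_divide powr_powr)
    also have "a * p = 1 / 2" using assms by (simp add: a_def)
    finally have "ln r powr p / r \<le> r powr (1 / 2) / a powr p / r"
      using elim by (intro divide_right_mono) auto
    also have "r powr (1 / 2) / a powr p / r = r powr (1 / 2 - 1) / a powr p"
      using elim by (simp only: powr_diff) simp
    finally show ?case by simp
  qed
  have lo: "eventually (\<lambda>r. 0 \<le> ln r powr p / r) at_top"
    using eventually_ge_at_top[of 0] by eventually_elim auto
  have lim: "((\<lambda>r::real. r powr (- 1 / 2) / a powr p) \<longlongrightarrow> 0) at_top"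
    by (intro tendsto_divide_zero tendsto_neg_powr filterlim_ident) auto
  show ?thesis by (rule tendsto_sandwich[OF lo up tendsto_const lim])
qed

lemma eventually_le_if_tendsto_0:
  fixes f :: "real \<Rightarrow> real"
  assumes "(f \<longlongrightarrow> 0) at_top" "e > 0"
  shows "eventually (\<lambda>r. f r \<le> e) at_top"
  using order_tendstoD(2)[OF assms] by eventually_elim auto

context plane_meromorphic
begin

text \<open>A good radius between \<open>t ^ 2\<close> and \<open>t ^ 3\<close> costs only a
  constant in \<open>ln R\<close>, and dividing by \<open>ln t\<close> lowers the exponent by
  one.\<close>

lemma div_count_growth:
  assumes p: "p > 0" and T: "eventually (\<lambda>R. nevanlinna_char g R \<le> ln R powr p) at_top"
  obtains C where "C \<ge> 0" "eventually (\<lambda>t. div_count t \<le> C * ln t powr (p - 1)) at_top"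
proof
  \<comment> \<open>The factor \<open>3 powr p\<close> comes from
    \<open>ln R \<le> 3 * ln t\<close>; the constant \<open>ln_lead\<close> is absorbed because
    \<open>ln t \<ge> 1\<close>.\<close>
  define C where "C = 2 * 3 powr p + \<bar>ln_lead\<bar>"
  show "C \<ge> 0" by (simp add: C_def)
  obtain R0 where R0: "\<And>R. R \<ge> R0 \<Longrightarrow> nevanlinna_char g R \<le> ln R powr p"
    using T by (auto simp: eventually_at_top_linorder)
  show "eventually (\<lambda>t. div_count t \<le> C * ln t powr (p - 1)) at_top"
    using eventually_ge_at_top[of R0] eventually_gt_at_top[of 1] eventually_ln_ge[of 1]
  proof eventually_elim
    case (elim t)
    have t2: "t \<le> t ^ 2" "t ^ 2 < t ^ 3" using elim by (auto simp: power2_eq_square power3_eq_cube)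
    obtain R where R: "t ^ 2 \<le> R" "R \<le> t ^ 3" "good R"
      using good_radius_exists[of "t ^ 2" "t ^ 3"] t2 elim by auto
    have "ln R \<le> ln (t ^ 3)" using R t2 elim by (subst ln_le_cancel_iff) auto
    also have "\<dots> = 3 * ln t" using elim by (simp add: ln_realpow)
    finally have lnR: "ln R \<le> 3 * ln t" .
    have "ln R \<ge> 0" using R t2 elim by auto
    hence "ln R powr p \<le> (3 * ln t) powr p" using lnR p by (intro powr_mono2) auto
    also have "\<dots> = 3 powr p * ln t powr p" using elim by (simp add: powr_mult)
    finally have "nevanlinna_char g R \<le> 3 powr p * ln t powr p"
      using R0[of R] R t2 elim by auto
    moreover have "\<bar>ln_lead\<bar> * 1 \<le> \<bar>ln_lead\<bar> * ln t powr p"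
      using elim p by (intro mult_left_mono ge_one_powr_ge_zero) auto
    ultimately have "2 * nevanlinna_char g R - ln_lead \<le> C * ln t powr p"
      unfolding C_def distrib_right by linarith
    moreover have "div_count t * ln t \<le> 2 * nevanlinna_char g R - ln_lead"
      using elim R by (intro div_count_le) auto
    ultimately have "div_count t * ln t \<le> C * ln t powr p" by linarith
    hence "div_count t \<le> C * ln t powr p / ln t" using elim by (simp add: field_simps)
    also have "\<dots> = C * ln t powr (p - 1)" using elim by (simp add: powr_diff)
    finally show ?case .
  qed
qed

text \<open>The disc is chosen so much larger than \<open>r\<close> that the variation of
  \<open>h\<close> on the scale of \<open>r\<close> is \<open>O(ln r powr p / r)\<close>. The factor
  \<open>ln (1 + 2 * R)\<close> costs one logarithm, which the bound for \<open>div_count\<close>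
  compensates.\<close>

lemma good_factorization:
  assumes p: "p > 0" and T: "eventually (\<lambda>R. nevanlinna_char g R \<le> ln R powr p) at_top"
  obtains D where "D \<ge> 0" "eventually (\<lambda>r. \<exists>R h. good R \<and> r ^ 2 \<le> R \<and> R \<le> r ^ 3 \<and>
    (\<forall>z. norm z \<le> R / 2 \<longrightarrow>
       (z \<notin> bad \<longrightarrow> g z = (\<Prod>s\<in>div_pts R. (z - s) powi zorder g s) * exp (h z)) \<and>
       norm (h z - h 0) \<le> norm z / r ^ 2 * (D * ln r powr p))) at_top"
proof -
  obtain C where C: "C \<ge> 0" "eventually (\<lambda>t. div_count t \<le> C * ln t powr (p - 1)) at_top"
    by (rule div_count_growth[OF assms])
  \<comment> \<open>The 5 comes from \<open>1 + 2 * R \<le> r ^ 5\<close>, valid for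
    \<open>r \<ge> 2\<close>, and \<open>3 powr (p - 1)\<close> from counting up to
    \<open>r ^ 3\<close>.\<close>
  define B where "B = 2 * 3 powr p + \<bar>ln_lead\<bar> + 2 * (C * 3 powr (p - 1)) * 5"
  obtain R0 where R0: "\<And>R. R \<ge> R0 \<Longrightarrow> nevanlinna_char g R \<le> ln R powr p"
    using T by (auto simp: eventually_at_top_linorder)
  obtain R1 where R1: "\<And>t. t \<ge> R1 \<Longrightarrow> div_count t \<le> C * ln t powr (p - 1)"
    using C(2) by (auto simp: eventually_at_top_linorder)
  show ?thesis
  proof
    show "0 \<le> 4 * B" using C by (simp add: B_def)
    show "eventually (\<lambda>r. \<exists>R h. good R \<and> r ^ 2 \<le> R \<and> R \<le> r ^ 3 \<and>
      (\<forall>z. norm z \<le> R / 2 \<longrightarrow>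
       (z \<notin> bad \<longrightarrow> g z = (\<Prod>s\<in>div_pts R. (z - s) powi zorder g s) * exp (h z)) \<and>
       norm (h z - h 0) \<le> norm z / r ^ 2 * (4 * B * ln r powr p))) at_top"
      using eventually_ge_at_top[of R0] eventually_ge_at_top[of R1] eventually_ge_at_top[of 2] eventually_ln_ge[of 1]
    proof eventually_elim
      case (elim r)
      have r1: "r \<ge> 1" using elim by simp
      have r2: "r \<le> r ^ 2" "r ^ 2 < r ^ 3" "r ^ 2 \<le> r ^ 3"
        using elim by (auto simp: power2_eq_square power3_eq_cube)
      obtain R where R: "r ^ 2 \<le> R" "R \<le> r ^ 3" "good R"
        using good_radius_exists[of "r ^ 2" "r ^ 3"] r2 elim by auto
      have "R \<ge> 1" using R r2 r1 by linarith
      have ln3: "ln (r ^ 3) = 3 * ln r" using elim by (simp add: ln_realpow)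
      have "ln R \<le> ln (r ^ 3)" using \<open>R \<ge> 1\<close> R(2) r1 by (subst ln_le_cancel_iff) auto
      hence "ln R powr p \<le> (3 * ln r) powr p" using \<open>R \<ge> 1\<close> p by (intro powr_mono2) (auto simp: ln3)
      also have "\<dots> = 3 powr p * ln r powr p" using elim by (simp add: powr_mult)
      finally have T1: "nevanlinna_char g R \<le> 3 powr p * ln r powr p"
        using R0[of R] R(1) r2 elim(1) by linarith
      \<comment> \<open>The count is enlarged to \<open>r ^ 3\<close> first: the sign of
        \<open>p - 1\<close> is unknown, so \<open>ln R powr (p - 1)\<close> could not be compared
        by monotonicity.\<close>
      have "div_count R \<le> div_count (r ^ 3)" using R(2) by (rule div_count_mono)
      also have "\<dots> \<le> C * ln (r ^ 3) powr (p - 1)" using R1[of "r ^ 3"] r2 elim by linarith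
      also have "\<dots> = C * 3 powr (p - 1) * ln r powr (p - 1)" using elim by (simp add: ln3 powr_mult)
      finally have c1: "div_count R \<le> C * 3 powr (p - 1) * ln r powr (p - 1)" .
      have "1 + 2 * R \<le> r ^ 5"
      proof -
        have r3: "r ^ 3 \<ge> 1" using r1 by (rule one_le_power)
        have "r ^ 2 \<ge> 2 ^ 2" using elim by (intro power_mono) auto
        hence "r ^ 3 * 4 \<le> r ^ 3 * r ^ 2" using r3 by (intro mult_left_mono) (use r1 in auto)
        also have "\<dots> = r ^ 5" by (simp flip: power_add)
        finally show ?thesis using R(2) r3 by linarith
      qed
      hence "ln (1 + 2 * R) \<le> ln (r ^ 5)" using \<open>R \<ge> 1\<close> r1 by (subst ln_le_cancel_iff) auto
      hence l5: "ln (1 + 2 * R) \<le> 5 * ln r" using elim by (simp add: ln_realpow)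
      have "div_count R * ln (1 + 2 * R) \<le> (C * 3 powr (p - 1) * ln r powr (p - 1)) * (5 * ln r)"
        using c1 l5 C(1) \<open>R \<ge> 1\<close> by (intro mult_mono mult_nonneg_nonneg) auto
      also have "\<dots> = C * 3 powr (p - 1) * 5 * ln r powr p"
        using elim by (simp add: powr_diff)
      finally have c2: "div_count R * ln (1 + 2 * R) \<le> C * 3 powr (p - 1) * 5 * ln r powr p" .
      have "\<bar>ln_lead\<bar> * 1 \<le> \<bar>ln_lead\<bar> * ln r powr p"
        using elim p by (intro mult_left_mono ge_one_powr_ge_zero) auto
      hence B: "2 * nevanlinna_char g R - ln_lead + 2 * div_count R * ln (1 + 2 * R) \<le> B * ln r powr p"
        using T1 c2 unfolding B_def distrib_right by (simp add: algebra_simps)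
      obtain h A where hA: "open A" "cball 0 R \<subseteq> A" "h holomorphic_on A"
        "\<And>z. z \<in> A \<Longrightarrow> z \<notin> bad \<Longrightarrow> g z = (\<Prod>s\<in>div_pts R. (z - s) powi zorder g s) * exp (h z)"
        using factorization[OF R(3)] by metis
      show ?case
      proof (rule exI[of _ R], rule exI[of _ h], intro conjI R allI impI)
        fix z :: complex assume z: "norm z \<le> R / 2" and "z \<notin> bad"
        have "z \<in> A" using z \<open>R \<ge> 1\<close> hA(2) by auto
        thus "g z = (\<Prod>s\<in>div_pts R. (z - s) powi zorder g s) * exp (h z)"
          using hA(4) \<open>z \<notin> bad\<close> by blast
      next
        fix z :: complex assume z: "norm z \<le> R / 2"
        have "norm (h z - h 0) \<le> 4 * norm z / R * (2 * nevanlinna_char g R - ln_lead + 2 * div_count R * ln (1 + 2 * R))"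
          by (rule log_factor_bound[OF R(3) \<open>R \<ge> 1\<close> hA z])
        also have "\<dots> \<le> 4 * norm z / R * (B * ln r powr p)"
          using B \<open>R \<ge> 1\<close> by (intro mult_left_mono) auto
        also have "\<dots> \<le> 4 * norm z / r ^ 2 * (B * ln r powr p)"
          using R(1) \<open>R \<ge> 1\<close> r1 C by (intro mult_right_mono divide_left_mono mult_nonneg_nonneg mult_pos_pos) (auto simp: B_def)
        finally show "norm (h z - h 0) \<le> norm z / r ^ 2 * (4 * B * ln r powr p)" by (simp add: mult_ac)
      qed
    qed
  qed
qed

text \<open>Without zeros and poles \<open>g = exp h\<close> on each disc, and for fixed
  \<open>z\<close> and \<open>w\<close> the difference \<open>h z - h w\<close> tends to 0 as the
  disc grows.\<close>

lemma constant_if_no_divisor: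
  assumes p: "p > 0" and T: "eventually (\<lambda>R. nevanlinna_char g R \<le> ln R powr p) at_top"
    and "\<And>s. zorder g s = 0"
  shows "\<exists>a. \<forall>\<^sub>\<approx>z. g z = a"
proof -
  obtain D where D: "D \<ge> 0" "eventually (\<lambda>r. \<exists>R h. good R \<and> r ^ 2 \<le> R \<and> R \<le> r ^ 3 \<and>
    (\<forall>z. norm z \<le> R / 2 \<longrightarrow>
       (z \<notin> bad \<longrightarrow> g z = (\<Prod>s\<in>div_pts R. (z - s) powi zorder g s) * exp (h z)) \<and>
       norm (h z - h 0) \<le> norm z / r ^ 2 * (D * ln r powr p))) at_top"
    by (rule good_factorization[OF p T])
  have emp: "div_pts R = {}" for R using assms(3) by (auto simp: div_pts_def)
  have eq: "g z = g w" if "z \<notin> bad" "w \<notin> bad" for z w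
  proof (rule ccontr)
    assume neq: "g z \<noteq> g w"
    \<comment> \<open>The logarithm \<open>h\<close> changes with \<open>r\<close>, but this
      quotient does not; it is the exponential of arbitrarily small numbers and hence 1.\<close>
    define q where "q = g z / g w"
    have "g w \<noteq> 0" using that by (auto simp: bad_def)
    hence "q \<noteq> 1" using neq by (simp add: q_def)
    have "isCont (exp :: complex \<Rightarrow> complex) 0" by simp
    then obtain d where d: "d > 0" "\<And>x :: complex. dist x 0 < d \<Longrightarrow> dist (exp x) (exp 0) < dist q 1"
      using \<open>q \<noteq> 1\<close> unfolding continuous_at_eps_delta by (metis zero_less_dist_iff)
    have "((\<lambda>r. (norm z + norm w) * D * (1 / r) * (ln r powr p / r)) \<longlongrightarrow> (norm z + norm w) * D * 0 * 0) at_top"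
      by (intro tendsto_intros ln_powr_div_tendsto_0 p tendsto_divide_0[OF tendsto_const]
          filterlim_at_top_imp_at_infinity filterlim_ident)
    hence "eventually (\<lambda>r. (norm z + norm w) * D * (1 / r) * (ln r powr p / r) \<le> d / 2) at_top"
      using d(1) by (intro eventually_le_if_tendsto_0) auto
    with D(2) eventually_ge_at_top[of 1] eventually_ge_at_top[of "2 * (norm z + norm w)"]
    have "eventually (\<lambda>r::real. False) at_top"
    proof eventually_elim
      case (elim r)
      from elim(1) obtain R h where R: "r ^ 2 \<le> R" and h: "\<And>z. norm z \<le> R / 2 \<Longrightarrow>
        (z \<notin> bad \<longrightarrow> g z = (\<Prod>s\<in>div_pts R. (z - s) powi zorder g s) * exp (h z)) \<and>
        norm (h z - h 0) \<le> norm z / r ^ 2 * (D * ln r powr p)" by blast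
      have "r \<le> r ^ 2" using elim(2) by (simp add: power2_eq_square)
      hence zw: "norm z \<le> R / 2" "norm w \<le> R / 2"
        using R elim(3) norm_ge_zero[of z] norm_ge_zero[of w] unfolding distrib_left by linarith+
      have "g z = exp (h z)" "g w = exp (h w)"
        using h[OF zw(1)] h[OF zw(2)] that emp by auto
      hence q: "q = exp (h z - h w)" by (simp add: q_def exp_diff)
      have "norm (h z - h w) \<le> norm (h z - h 0) + norm (h w - h 0)"
        using norm_triangle_ineq4[of "h z - h 0" "h w - h 0"] by simp
      also have "\<dots> \<le> norm z / r ^ 2 * (D * ln r powr p) + norm w / r ^ 2 * (D * ln r powr p)"
        using h[OF zw(1)] h[OF zw(2)] by (intro add_mono) auto
      also have "\<dots> = (norm z + norm w) * D * (1 / r) * (ln r powr p / r)"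
        using elim(2) by (simp add: field_simps power2_eq_square)
      also have "\<dots> \<le> d / 2" by (rule elim(4))
      finally have "dist (exp (h z - h w)) (exp 0) < dist q 1"
        using d(1) by (intro d(2)) simp
      thus False using q by simp
    qed
    thus False by simp
  qed
  have "\<forall>\<^sub>\<approx>z. z \<notin> bad" using bad_sparse by (simp add: eventually_cosparse)
  moreover from this have "\<exists>w. w \<notin> bad"
    using eventually_happens'[of "cosparse UNIV"] by fastforce
  then obtain w where "w \<notin> bad" by blast
  ultimately have "\<forall>\<^sub>\<approx>z. g z = g w" by (auto elim!: eventually_mono intro: eq)
  thus ?thesis by blast
qed

text \<open>A single zero or pole makes \<open>div_count\<close> at least 1 eventually, so its upper
  bound absorbs constants. This is how bounded error terms fit into the final estimate.\<close>

lemma log_growth_ge_const: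
  assumes p: "p > 0" and T: "eventually (\<lambda>R. nevanlinna_char g R \<le> ln R powr p) at_top"
    and s: "zorder g s \<noteq> 0"
  obtains C where "C \<ge> 0" "eventually (\<lambda>r. 1 \<le> C * ln r powr (p - 1)) at_top"
proof -
  obtain C where C: "C \<ge> 0" "eventually (\<lambda>t. div_count t \<le> C * ln t powr (p - 1)) at_top"
    by (rule div_count_growth[OF p T])
  from C(2) eventually_ge_at_top[of "norm s"]
  have "eventually (\<lambda>r. 1 \<le> C * ln r powr (p - 1)) at_top"
  proof eventually_elim
    case (elim r)
    have "1 \<le> real_of_int \<bar>zorder g s\<bar>" using s by linarith
    also have "\<dots> \<le> div_count r" unfolding div_count_def using elim s finite_div_pts
      by (intro member_le_sum[of s _ "\<lambda>s. real_of_int \<bar>zorder g s\<bar>"]) (auto simp: div_pts_def)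
    finally show ?case using elim by linarith
  qed
  with C(1) show ?thesis by (rule that)
qed

lemma log_plus_factor_quotient_le:
  assumes "z \<notin> bad" "w \<notin> bad"
    and gz: "g z = (\<Prod>s\<in>div_pts R. (z - s) powi zorder g s) * exp (h z)"
    and gw: "g w = (\<Prod>s\<in>div_pts R. (w - s) powi zorder g s) * exp (h w)"
  shows "log_plus (norm (g w / g z)) \<le> (\<Sum>s\<in>div_pts R. of_int \<bar>zorder g s\<bar> *
      (log_plus (norm ((w - s) / (z - s))) + log_plus (inverse (norm ((w - s) / (z - s)))))) + norm (h w - h z)"
proof -
  have "g w / g z = (\<Prod>s\<in>div_pts R. ((w - s) / (z - s)) powi zorder g s) * exp (h w - h z)"
    unfolding gz gw by (simp add: exp_diff power_int_divide_distrib prod_dividef)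
  hence "norm (g w / g z) = (\<Prod>s\<in>div_pts R. norm ((w - s) / (z - s)) powi zorder g s) * norm (exp (h w - h z))"
    by (simp only: norm_mult norm_power_int flip: prod_norm)
  also have "log_plus \<dots> \<le> log_plus (\<Prod>s\<in>div_pts R. norm ((w - s) / (z - s)) powi zorder g s) +
      log_plus (norm (exp (h w - h z)))"
    by (intro log_plus_mult_le prod_nonneg) auto
  also have "log_plus (norm (exp (h w - h z))) \<le> norm (h w - h z)"
    by (rule log_plus_norm_exp_le)
  also have "log_plus (\<Prod>s\<in>div_pts R. norm ((w - s) / (z - s)) powi zorder g s) \<le>
      (\<Sum>s\<in>div_pts R. log_plus (norm ((w - s) / (z - s)) powi zorder g s))"
    by (intro log_plus_prod_le) auto
  also have "\<dots> \<le> (\<Sum>s\<in>div_pts R. of_int \<bar>zorder g s\<bar> *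
      (log_plus (norm ((w - s) / (z - s))) + log_plus (inverse (norm ((w - s) / (z - s))))))"
    by (intro sum_mono log_plus_power_int_le) auto
  finally show ?thesis by simp
qed

text \<open>Each divisor point contributes at most a constant times its multiplicity, so the product
  costs \<open>O(div_count R)\<close>, while the exponential factor contributes at most 1.\<close>

lemma affine_quotient_bound:
  fixes a b :: complex
  assumes p: "p > 0" and T: "eventually (\<lambda>R. nevanlinna_char g R \<le> ln R powr p) at_top"
    and s0: "zorder g s0 \<noteq> 0" and a: "a \<noteq> 0"
  obtains K where "eventually (\<lambda>r. circle_upper_le
     (\<lambda>t. log_plus (norm (g (a * (r * cis t) + b) / g (r * cis t)))) (K * ln r powr (p - 1))) at_top"
proof -
  obtain D where D: "D \<ge> 0" "eventually (\<lambda>r. \<exists>R h. good R \<and> r ^ 2 \<le> R \<and> R \<le> r ^ 3 \<and>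
    (\<forall>z. norm z \<le> R / 2 \<longrightarrow>
       (z \<notin> bad \<longrightarrow> g z = (\<Prod>s\<in>div_pts R. (z - s) powi zorder g s) * exp (h z)) \<and>
       norm (h z - h 0) \<le> norm z / r ^ 2 * (D * ln r powr p))) at_top"
    by (rule good_factorization[OF p T])
  obtain C where C: "C \<ge> 0" "eventually (\<lambda>t. div_count t \<le> C * ln t powr (p - 1)) at_top"
    by (rule div_count_growth[OF p T])
  obtain R1 where R1: "\<And>t. t \<ge> R1 \<Longrightarrow> div_count t \<le> C * ln t powr (p - 1)"
    using C(2) by (auto simp: eventually_at_top_linorder)
  obtain C1 where C1: "C1 \<ge> 0" "eventually (\<lambda>r. 1 \<le> C1 * ln r powr (p - 1)) at_top"
    by (rule log_growth_ge_const[OF p T s0])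
  obtain K0 where K0: "\<And>(r::real) (s::complex). (1::real) \<le> r \<Longrightarrow> circle_upper_le
    (\<lambda>t. log_plus (norm ((a * (r * cis t) + b - s) / (r * cis t - s))) +
         log_plus (inverse (norm ((a * (r * cis t) + b - s) / (r * cis t - s))))) K0"
    by (rule circle_log_ratio_bound[OF a, of b]) auto
  \<comment> \<open>For \<open>|z| = r \<ge> 1\<close> one has
    \<open>|z| + |a * z + b| \<le> c * r\<close>.\<close>
  define c where "c = norm a + norm b + 1"
  \<comment> \<open>The first term pays for the divisor points up to \<open>r ^ 3\<close>, the
    second for the bounded exponential factor. The absolute value is taken because \<open>K0\<close>
    comes without a sign.\<close>
  define K where "K = \<bar>K0\<bar> * (C * 3 powr (p - 1)) + 2 * pi * C1"
  have "((\<lambda>r. c * D * (ln r powr p / r)) \<longlongrightarrow> c * D * 0) at_top"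
    by (intro tendsto_intros ln_powr_div_tendsto_0 p)
  hence "eventually (\<lambda>r. c * D * (ln r powr p / r) \<le> 1) at_top"
    by (intro eventually_le_if_tendsto_0) auto
  with D(2) C1(2) eventually_ge_at_top[of R1] eventually_ge_at_top[of "2 * c"] eventually_ge_at_top[of 2]
  have "eventually (\<lambda>r. circle_upper_le
     (\<lambda>t. log_plus (norm (g (a * (r * cis t) + b) / g (r * cis t)))) (K * ln r powr (p - 1))) at_top"
  proof eventually_elim
    case (elim r)
    from elim(1) obtain R h where R: "r ^ 2 \<le> R" "R \<le> r ^ 3"
      and h1: "\<And>z. norm z \<le> R / 2 \<Longrightarrow> z \<notin> bad \<Longrightarrow>
          g z = (\<Prod>s\<in>div_pts R. (z - s) powi zorder g s) * exp (h z)"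
      and h2: "\<And>z. norm z \<le> R / 2 \<Longrightarrow> norm (h z - h 0) \<le> norm z / r ^ 2 * (D * ln r powr p)"
      by blast
    have r1: "r \<ge> 1" using elim by simp
    have "r * 1 \<le> r ^ 2" using r1 unfolding power2_eq_square by (intro mult_left_mono) auto
    moreover have "r ^ 2 * 1 \<le> r ^ 2 * r" using r1 by (intro mult_left_mono) auto
    ultimately have r3: "r \<le> r ^ 3" by (simp add: power2_eq_square power3_eq_cube)
    \<comment> \<open>At these angles the factorization may fail at \<open>z\<close> or at its
      image.\<close>
    define N where "N = {t \<in> {0..2 * pi}. r * cis t \<in>
        (cball 0 R \<inter> bad) \<union> (\<lambda>z. a * z + b) -` (cball 0 R \<inter> bad)}"
    have "finite N" unfolding N_def
    proof (rule finite_circle_vimage)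
      have "inj (\<lambda>z. a * z + b)" using a by (auto simp: inj_on_def)
      thus "finite (cball 0 R \<inter> bad \<union> (\<lambda>z. a * z + b) -` (cball 0 R \<inter> bad))"
        using finite_bad by (intro finite_UnI finite_vimageI) auto
    qed (use r1 in auto)
    define F where "F = (\<lambda>t. (\<Sum>s\<in>div_pts R. of_int \<bar>zorder g s\<bar> *
      (log_plus (norm ((a * (r * cis t) + b - s) / (r * cis t - s))) +
       log_plus (inverse (norm ((a * (r * cis t) + b - s) / (r * cis t - s)))))) + 1)"
    have F: "circle_upper_le F ((\<Sum>s\<in>div_pts R. of_int \<bar>zorder g s\<bar> * K0) + 2 * pi * 1)"
      unfolding F_def
      by (intro circle_upper_le_add circle_upper_le_sum circle_upper_le_cmult circle_upper_le_const K0 r1) auto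
    have "(\<Sum>s\<in>div_pts R. of_int \<bar>zorder g s\<bar> * K0) + 2 * pi * 1 \<le> K * ln r powr (p - 1)"
    proof -
      have "div_count R \<le> div_count (r ^ 3)" using R(2) by (rule div_count_mono)
      also have "\<dots> \<le> C * ln (r ^ 3) powr (p - 1)" using R1[of "r ^ 3"] r3 elim by linarith
      also have "\<dots> = C * 3 powr (p - 1) * ln r powr (p - 1)" using r1 by (simp add: ln_realpow powr_mult)
      finally have c1: "div_count R \<le> C * 3 powr (p - 1) * ln r powr (p - 1)" .
      have "(\<Sum>s\<in>div_pts R. of_int \<bar>zorder g s\<bar> * K0) = K0 * div_count R"
        by (simp add: div_count_def sum_distrib_left mult.commute)
      also have "\<dots> \<le> \<bar>K0\<bar> * div_count R"
        using div_count_nonneg by (intro mult_right_mono) auto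
      also have "\<dots> \<le> \<bar>K0\<bar> * (C * 3 powr (p - 1) * ln r powr (p - 1))"
        using c1 by (intro mult_left_mono) auto
      finally have "(\<Sum>s\<in>div_pts R. of_int \<bar>zorder g s\<bar> * K0) \<le>
          \<bar>K0\<bar> * (C * 3 powr (p - 1) * ln r powr (p - 1))" .
      moreover have "2 * pi * 1 \<le> 2 * pi * (C1 * ln r powr (p - 1))"
        using elim(2) by (intro mult_left_mono) auto
      ultimately have "(\<Sum>s\<in>div_pts R. of_int \<bar>zorder g s\<bar> * K0) + 2 * pi * 1 \<le>
          \<bar>K0\<bar> * (C * 3 powr (p - 1) * ln r powr (p - 1)) + 2 * pi * (C1 * ln r powr (p - 1))"
        by (rule add_mono)
      also have "\<dots> = K * ln r powr (p - 1)" unfolding K_def by (simp add: algebra_simps)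
      finally show ?thesis .
    qed
    from F \<open>finite N\<close> this show ?case
    proof (rule circle_upper_le_mono)
      fix t assume t: "t \<in> {0..2 * pi} - N"
      define z w where "z = r * cis t" and "w = a * z + b"
      have nz: "norm z = r" using r1 by (simp add: z_def norm_mult)
      have nw: "norm w \<le> norm a * r + norm b"
        unfolding w_def using norm_triangle_ineq[of "a * z" b] nz by (simp add: norm_mult)
      have "norm a * r + norm b * 1 + r \<le> norm a * r + norm b * r + r"
        using r1 by (intro add_mono mult_left_mono) auto
      hence nzw: "norm w + norm z \<le> c * r" using nw nz unfolding c_def by (simp add: algebra_simps)
      \<comment> \<open>Since \<open>R \<ge> r ^ 2\<close>, the condition
        \<open>r \<ge> 2 * c\<close> puts both points into the half disc.\<close>
      have "2 * c * r \<le> r * r" using elim(4) r1 by (intro mult_right_mono) auto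
      hence "c * r \<le> R / 2" using R(1) by (simp add: power2_eq_square)
      hence le: "norm z \<le> R / 2" "norm w \<le> R / 2"
        using nzw norm_ge_zero[of z] norm_ge_zero[of w] by linarith+
      have "R \<ge> 0" using le(1) norm_ge_zero[of z] by linarith
      hence nb: "z \<notin> bad" "w \<notin> bad"
        using t le unfolding N_def w_def z_def by auto
      have "norm (h w - h z) \<le> norm (h w - h 0) + norm (h z - h 0)"
        using norm_triangle_ineq4[of "h w - h 0" "h z - h 0"] by simp
      also have "\<dots> \<le> norm w / r ^ 2 * (D * ln r powr p) + norm z / r ^ 2 * (D * ln r powr p)"
        using h2 le by (intro add_mono) auto
      also have "\<dots> = (norm w + norm z) / r ^ 2 * (D * ln r powr p)"
        by (simp add: add_divide_distrib algebra_simps)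
      also have "\<dots> \<le> (c * r) / r ^ 2 * (D * ln r powr p)"
        using nzw D(1) by (intro mult_right_mono divide_right_mono) auto
      also have "\<dots> = c * D * (ln r powr p / r)"
        using r1 by (simp add: power2_eq_square)
      also have "\<dots> \<le> 1" by (rule elim(6))
      finally have "norm (h w - h z) \<le> 1" .
      with log_plus_factor_quotient_le[OF nb h1[OF le(1) nb(1)] h1[OF le(2) nb(2)]]
      show "log_plus (norm (g (a * (r * cis t) + b) / g (r * cis t))) \<le> F t"
        unfolding F_def z_def w_def by linarith
    qed
  qed
  thus ?thesis by (rule that)
qed

end

section \<open>Iterates of the Hahn operator and the final estimate\<close>

lemma filterlim_affine_at_infinity:
  fixes a b :: complex
  assumes "a \<noteq> 0"
  shows "filterlim (\<lambda>z. a * z + b) at_infinity at_infinity"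
proof (rule tendsto_add_filterlim_at_infinity'[OF _ tendsto_const])
  show "filterlim (\<lambda>z. a * z) at_infinity at_infinity"
    by (rule tendsto_mult_filterlim_at_infinity[OF tendsto_const assms filterlim_ident])
qed

text \<open>Far out the denominator has modulus at least 1. One application then adds the bounds at
  \<open>z\<close> and at \<open>q * z + c\<close>, which doubles the constant and brings in one
  more shift.\<close>

lemma hahn_diff_iterate_bound:
  fixes q c :: complex
  assumes "q \<noteq> 0" "q \<noteq> 1"
  shows "eventually (\<lambda>z. norm ((hahn_diff q c ^^ k) g z) \<le>
    2 ^ k * (\<Sum>j\<le>k. norm (g (((\<lambda>z. q * z + c) ^^ j) z)))) at_infinity"
proof (induction k)
  case 0
  show ?case by simp
next
  case (Suc k)
  define L where "L = (\<lambda>z. q * z + c)"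
  define S where "S = (\<lambda>k z. \<Sum>j\<le>k. norm (g ((L ^^ j) z)))"
  have "eventually (\<lambda>z. norm ((q - 1) * z + c) \<ge> 1) at_infinity"
    using filterlim_at_infinity_imp_norm_at_top[OF filterlim_affine_at_infinity[of "q - 1" c]] assms
    by (simp add: filterlim_at_top)
  \<comment> \<open>The affine map tends to infinity with \<open>z\<close>, so the induction
    hypothesis also holds at the shifted point.\<close>
  moreover have "eventually (\<lambda>z. norm ((hahn_diff q c ^^ k) g (L z)) \<le> 2 ^ k * S k (L z)) at_infinity"
    using eventually_compose_filterlim[OF Suc filterlim_affine_at_infinity[OF assms(1), of c]]
    by (simp add: L_def S_def)
  ultimately have "eventually (\<lambda>z. norm ((hahn_diff q c ^^ Suc k) g z) \<le> 2 ^ Suc k * S (Suc k) z) at_infinity"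
    using Suc
  proof eventually_elim
    case (elim z)
    define f where "f = (hahn_diff q c ^^ k) g"
    have "(\<Sum>j\<le>k. norm (g ((L ^^ j) (L z)))) = (\<Sum>j\<in>Suc ` {..k}. norm (g ((L ^^ j) z)))"
      by (subst sum.reindex) (auto simp: funpow_swap1)
    also have "\<dots> \<le> S (Suc k) z" unfolding S_def by (intro sum_mono2) auto
    finally have S1: "S k (L z) \<le> S (Suc k) z" by (simp add: S_def)
    have S2: "S k z \<le> S (Suc k) z" unfolding S_def by (intro sum_mono2) auto
    have "norm ((hahn_diff q c ^^ Suc k) g z) = norm (f (L z) - f z) / norm ((q - 1) * z + c)"
      by (simp add: f_def hahn_diff_def L_def norm_divide)
    also have "\<dots> \<le> norm (f (L z) - f z) / 1"
      using elim(1) by (intro divide_left_mono) auto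
    also have "\<dots> \<le> norm (f (L z)) + norm (f z)"
      using norm_triangle_ineq4 by simp
    also have "\<dots> \<le> 2 ^ k * S k (L z) + 2 ^ k * S k z"
      using elim(2,3) by (intro add_mono) (auto simp: f_def S_def L_def)
    also have "\<dots> \<le> 2 ^ k * S (Suc k) z + 2 ^ k * S (Suc k) z"
      using S1 S2 by (intro add_mono mult_left_mono) auto
    finally show ?case by (simp add: mult_ac)
  qed
  thus ?case by (simp add: S_def L_def)
qed

lemma affine_funpow:
  fixes q c :: complex
  obtains b where "\<And>z. ((\<lambda>z. q * z + c) ^^ j) z = q ^ j * z + b"
proof (induction j arbitrary: thesis)
  case 0
  show ?case by (rule 0[of 0]) simp
next
  case (Suc j)
  obtain b where "\<And>z. ((\<lambda>z. q * z + c) ^^ j) z = q ^ j * z + b" using Suc(1) by metis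
  thus ?case by (intro Suc(2)[of "q * b + c"]) (simp add: algebra_simps)
qed

lemma nevanlinna_char_growth:
  assumes "log_order g = ereal \<rho>" "\<rho> < p"
  shows "0 < p" "eventually (\<lambda>r. nevanlinna_char g r \<le> ln r powr p) at_top"
proof -
  have lnln: "eventually (\<lambda>r::real. ln (ln r) \<ge> 1) at_top"
    using filterlim_compose[OF ln_at_top ln_at_top] by (simp add: filterlim_at_top)
  have "eventually (\<lambda>r. ereal (log_plus (nevanlinna_char g r) / ln (ln r)) < ereal p) at_top"
    using assms unfolding log_order_def by (intro Limsup_lessD) simp
  hence *: "eventually (\<lambda>r. log_plus (nevanlinna_char g r) / ln (ln r) < p) at_top" by simp
  \<comment> \<open>Once \<open>ln (ln r)\<close> is positive the quotient is nonnegative, so any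
    strict upper bound is positive.\<close>
  from * lnln have "eventually (\<lambda>r::real. 0 < p) at_top"
  proof eventually_elim
    case (elim r)
    have "0 \<le> log_plus (nevanlinna_char g r) / ln (ln r)"
      using elim by (intro divide_nonneg_nonneg log_plus_nonneg) auto
    thus ?case using elim by linarith
  qed
  thus "0 < p" by simp
  from * lnln eventually_ln_ge[of 1] show "eventually (\<lambda>r. nevanlinna_char g r \<le> ln r powr p) at_top"
  proof eventually_elim
    case (elim r)
    have "0 < ln (ln r)" using elim(2) by linarith
    with elim(1) have "log_plus (nevanlinna_char g r) < p * ln (ln r)"
      by (simp only: pos_divide_less_eq)
    hence "exp (log_plus (nevanlinna_char g r)) \<le> exp (p * ln (ln r))" by simp
    thus ?case using elim by (simp add: log_plus_def powr_def)
  qed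
qed

text \<open>A meromorphic function on the plane either equals 0 off a sparse set or avoids 0 off a
  sparse set.\<close>

lemma nonconstant_imp_plane_meromorphic:
  assumes "nonconstant_meromorphic g"
  shows "plane_meromorphic g"
  using assms meromorphic_imp_constant_or_avoid[of g UNIV 0]
  unfolding nonconstant_meromorphic_def by unfold_locales auto

theorem theorem3:
  fixes g :: "complex \<Rightarrow> complex" and q c :: complex and k :: nat and \<epsilon> :: real
  assumes "nonconstant_meromorphic g"
    and "\<bar>log_order g\<bar> \<noteq> \<infinity>"
    and "q \<noteq> 0" and "q \<noteq> 1"
    and "k \<ge> 1"
    and "\<epsilon> > 0"
  shows "proximity (\<lambda>z. (hahn_diff q c ^^ k) g z / g z)
           \<in> O[at_top](\<lambda>r. ln r powr (real_of_ereal (log_order g) - 1 + \<epsilon>))"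
proof -
  interpret plane_meromorphic g using assms(1) by (rule nonconstant_imp_plane_meromorphic)
  \<comment> \<open>The characteristic is eventually at most \<open>ln r powr p\<close>, and the
    target exponent is \<open>p - 1\<close>.\<close>
  define p where "p = real_of_ereal (log_order g) + \<epsilon>"
  have "log_order g = ereal (real_of_ereal (log_order g))" using assms(2) by (simp add: ereal_real)
  note p = nevanlinna_char_growth[OF this, of p]
  have p: "p > 0" "eventually (\<lambda>r. nevanlinna_char g r \<le> ln r powr p) at_top"
    using p assms(6) by (auto simp: p_def)
  \<comment> \<open>Nonconstancy enters here: slow growth forces a zero or a pole.\<close>
  obtain s where s: "zorder g s \<noteq> 0"
    using constant_if_no_divisor[OF p] assms(1) by (auto simp: nonconstant_meromorphic_def)
  define L where "L = (\<lambda>z. q * z + c)"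
  have "\<forall>j. \<exists>K. eventually (\<lambda>r. circle_upper_le
     (\<lambda>t. log_plus (norm (g ((L ^^ j) (r * cis t)) / g (r * cis t)))) (K * ln r powr (p - 1))) at_top"
  proof
    fix j
    obtain b where b: "\<And>z. (L ^^ j) z = q ^ j * z + b"
      unfolding L_def using affine_funpow by metis
    have "q ^ j \<noteq> 0" using assms(3) by simp
    thus "\<exists>K. eventually (\<lambda>r. circle_upper_le
       (\<lambda>t. log_plus (norm (g ((L ^^ j) (r * cis t)) / g (r * cis t)))) (K * ln r powr (p - 1))) at_top"
      unfolding b by (rule affine_quotient_bound[OF p s, of "q ^ j" b]) (rule exI)
  qed
  from choice[OF this] obtain K where K: "\<And>j. eventually (\<lambda>r. circle_upper_le
     (\<lambda>t. log_plus (norm (g ((L ^^ j) (r * cis t)) / g (r * cis t)))) (K j * ln r powr (p - 1))) at_top"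
    by blast
  have K: "eventually (\<lambda>r. \<forall>j\<in>{..k}. circle_upper_le
     (\<lambda>t. log_plus (norm (g ((L ^^ j) (r * cis t)) / g (r * cis t)))) (K j * ln r powr (p - 1))) at_top"
    by (intro eventually_ball_finite ballI K) auto
  obtain C where C: "C \<ge> 0" "eventually (\<lambda>r. 1 \<le> C * ln r powr (p - 1)) at_top"
    by (rule log_growth_ge_const[OF p s])
  obtain r0 where r0: "\<And>z. norm z \<ge> r0 \<Longrightarrow>
      norm ((hahn_diff q c ^^ k) g z) \<le> 2 ^ k * (\<Sum>j\<le>k. norm (g ((L ^^ j) z)))"
    using hahn_diff_iterate_bound[OF assms(3,4), where c = c and k = k and g = g] unfolding L_def eventually_at_infinity by blast
  \<comment> \<open>The two terms come from the factor \<open>2 ^ k\<close> and from splitting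
    \<open>log_plus\<close> of a sum of \<open>k + 1\<close> terms.\<close>
  define B where "B = log_plus (2 ^ k) + card {..k} * ln 2"
  have B: "B \<ge> 0" by (simp add: B_def log_plus_nonneg)
  \<comment> \<open>The constant \<open>B\<close> becomes \<open>B * C\<close> because
    \<open>1 \<le> C * ln r powr (p - 1)\<close> eventually.\<close>
  define M where "M = 1 / (2 * pi) * (2 * pi * (B * C) + (\<Sum>j\<le>k. K j))"
  have "eventually (\<lambda>r. norm (proximity (\<lambda>z. (hahn_diff q c ^^ k) g z / g z) r) \<le>
      M * norm (ln r powr (p - 1))) at_top"
    using K C(2) eventually_ge_at_top[of r0] eventually_ge_at_top[of 0]
  proof eventually_elim
    case (elim r)
    have ptw: "log_plus (norm ((hahn_diff q c ^^ k) g z / g z)) \<le>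
        B + (\<Sum>j\<le>k. log_plus (norm (g ((L ^^ j) z) / g z)))" if z: "norm z \<ge> r0" for z
    proof -
      have "norm ((hahn_diff q c ^^ k) g z / g z) \<le> 2 ^ k * (\<Sum>j\<le>k. norm (g ((L ^^ j) z))) / norm (g z)"
        unfolding norm_divide using r0[OF z] by (intro divide_right_mono) auto
      also have "\<dots> = 2 ^ k * (\<Sum>j\<le>k. norm (g ((L ^^ j) z) / g z))"
        by (simp add: norm_divide flip: sum_divide_distrib)
      finally have "log_plus (norm ((hahn_diff q c ^^ k) g z / g z)) \<le>
          log_plus (2 ^ k * (\<Sum>j\<le>k. norm (g ((L ^^ j) z) / g z)))" by (rule log_plus_mono)
      also have "\<dots> \<le> log_plus (2 ^ k) + log_plus (\<Sum>j\<le>k. norm (g ((L ^^ j) z) / g z))"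
        by (intro log_plus_mult_le sum_nonneg) auto
      also have "log_plus (\<Sum>j\<le>k. norm (g ((L ^^ j) z) / g z)) \<le>
          card {..k} * ln 2 + (\<Sum>j\<le>k. log_plus (norm (g ((L ^^ j) z) / g z)))"
        by (intro log_plus_sum_le) auto
      finally show ?thesis by (simp add: B_def)
    qed
    have "circle_upper_le (\<lambda>t. B + (\<Sum>j\<le>k. log_plus (norm (g ((L ^^ j) (r * cis t)) / g (r * cis t)))))
        (2 * pi * B + (\<Sum>j\<le>k. K j * ln r powr (p - 1)))"
      using elim(1) by (intro circle_upper_le_add circle_upper_le_const circle_upper_le_sum) auto
    hence "circle_upper_le (\<lambda>t. log_plus (norm ((hahn_diff q c ^^ k) g (r * cis t) / g (r * cis t))))
        (2 * pi * B + (\<Sum>j\<le>k. K j * ln r powr (p - 1)))"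
      by (rule circle_upper_le_mono[OF _ finite.emptyI order_refl])
         (rule ptw, use elim(3,4) in \<open>simp add: norm_mult\<close>)
    hence "integral {0..2 * pi} (\<lambda>t. log_plus (norm ((hahn_diff q c ^^ k) g (r * cis t) / g (r * cis t)))) \<le>
        2 * pi * B + (\<Sum>j\<le>k. K j * ln r powr (p - 1))"
      by (rule circle_upper_le_imp_integral_le) (rule log_plus_nonneg)
    also have "\<dots> \<le> 2 * pi * (B * (C * ln r powr (p - 1))) + (\<Sum>j\<le>k. K j * ln r powr (p - 1))"
      using mult_left_mono[OF elim(2) B] by simp
    also have "\<dots> = (2 * pi * (B * C) + (\<Sum>j\<le>k. K j)) * ln r powr (p - 1)"
      by (simp add: sum_distrib_right distrib_right)
    finally have "proximity (\<lambda>z. (hahn_diff q c ^^ k) g z / g z) r \<le>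
       1 / (2 * pi) * ((2 * pi * (B * C) + (\<Sum>j\<le>k. K j)) * ln r powr (p - 1))"
      unfolding proximity_def by (intro mult_left_mono) auto
    thus ?case by (simp add: M_def proximity_nonneg)
  qed
  hence "proximity (\<lambda>z. (hahn_diff q c ^^ k) g z / g z) \<in> O[at_top](\<lambda>r. ln r powr (p - 1))"
    by (rule bigoI)
  thus ?thesis by (simp add: p_def algebra_simps)
qed

end
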